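(* Suppose each $f_i:\mathbb{R}^d\to\mathbb{R}$, $i=1,\dots,n$, is $L$-smooth, i.e. $\|\nabla f_i(x)-\nabla f_i(y)\|\le L\|x-y\|$ for any $x,y\in\mathbb{R}^d$, and suppose the network topology is strongly connected and its weight matrix $W\in\mathbb{R}^{n\times n}$ is symmetric and satisfies $W\mathbf 1=\mathbf 1$. If each $f_i$ is further assumed to be strongly convex, and the full-batch gradient $\nabla f_i(x)$ is accessed per iteration, then DecentLaM with learning rate $\gamma$ and momentum coefficient $\beta\in(0,1)$ has an inconsistency bias as follows: $$\lim_{k\to\infty}\sum_{i=1}^n\|x_i^{(k)}-x^\star\|^2=O\Big(\frac{\gamma^2b^2}{(1-\rho)^2}\Big),$$ where $b^2=\frac1n\sum_{i=1}^n\|\nabla f_i(x^\star)\|^2$ denotes the data inconsistency between nodes, $x^\star$ is the global minimizer of $f(x)=\frac1n\sum_{i=1}^n f_i(x)$, and $\rho=\max\{|\lambda_2(W)|,|\lambda_n(W)|\}$.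
   Context: Network and weights: $n$ nodes are connected by an undirected topology. $W=[w_{ij}]$ with $w_{ij}>0$ if node $j$ is connected to node $i$ or $i=j$, and $w_{ij}=0$ otherwise; $\mathcal N_i=\{j:w_{ij}>0\}$. $\lambda_i(W)$ is the $i$-th largest eigenvalue of $W$, and $\rho\in(0,1)$. $\mathbf 1$ is the all-ones vector. DecentLaM with full-batch gradients: with initial $x_i^{(0)}$ and $m_i^{(0)}=0$, for $k=0,1,2,\dots$ every node $i$ computes $$g_i^{(k)}=\frac1\gamma x_i^{(k)}-\frac1\gamma\sum_{j\in\mathcal N_i}w_{ij}\big(x_j^{(k)}-\gamma\nabla f_j(x_j^{(k)})\big),\quad m_i^{(k+1)}=\beta m_i^{(k)}+g_i^{(k)},\quad x_i^{(k+1)}=x_i^{(k)}-\gamma m_i^{(k+1)}.$$ The inconsistency bias is the limiting error above when there is no gradient noise.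
   Formalization: The learning rate γ is taken sufficiently small (below a threshold depending only on n, L, the strong convexity modulus, β and ρ), since the iterates diverge for large γ; the O-constant depends only on n, L, the modulus and d. *)

theory Defs
  imports
    "HOL-Analysis.Analysis"
    "Graph_Theory.Graph_Theory"
    "Jordan_Normal_Form.Char_Poly"
begin

(* Unspecified where f is not differentiable. *)
definition grad :: "('a::real_inner \<Rightarrow> real) \<Rightarrow> 'a \<Rightarrow> 'a" where
  "grad f x = (THE D. GDERIV f x :> D)"

definition smooth_fun :: "real \<Rightarrow> ('a::real_inner \<Rightarrow> real) \<Rightarrow> bool" where
  "smooth_fun L f \<longleftrightarrow>
     (\<forall>x. \<exists>D. GDERIV f x :> D) \<and>
     (\<forall>x y. norm (grad f x - grad f y) \<le> L * norm (x - y))"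

definition strongly_convex_fun :: "real \<Rightarrow> ('a::real_inner \<Rightarrow> real) \<Rightarrow> bool" where
  "strongly_convex_fun \<mu> f \<longleftrightarrow>
     (\<forall>x y. \<forall>t\<in>{0..1}.
        f ((1 - t) *\<^sub>R x + t *\<^sub>R y)
          \<le> (1 - t) * f x + t * f y - \<mu> / 2 * t * (1 - t) * (norm (x - y))\<^sup>2)"

(* Nodes are {0..<n}.  Self-weights are positive although G has no loops. *)
definition weight_matrix :: "nat \<Rightarrow> nat pair_pre_digraph \<Rightarrow> real mat \<Rightarrow> bool" where
  "weight_matrix n G W \<longleftrightarrow>
     W \<in> carrier_mat n n \<and>
     (\<forall>i<n. \<forall>j<n.
        if (j, i) \<in> parcs G \<or> i = j then W $$ (i, j) > 0 else W $$ (i, j) = 0)"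

(* The i-th largest real eigenvalue (i = 1, 2, ...), counted with algebraic multiplicity;
   for a symmetric n x n matrix the list has exactly n entries. *)
definition nth_largest_eigenvalue :: "real mat \<Rightarrow> nat \<Rightarrow> real" where
  "nth_largest_eigenvalue W i = rev (sorted_list_of_multiset (proots (char_poly W))) ! (i - 1)"

definition mixing_rate :: "nat \<Rightarrow> real mat \<Rightarrow> real" where
  "mixing_rate n W = max \<bar>nth_largest_eigenvalue W 2\<bar> \<bar>nth_largest_eigenvalue W n\<bar>"

definition neighbours :: "nat \<Rightarrow> real mat \<Rightarrow> nat \<Rightarrow> nat set" where
  "neighbours n W i = {j. j < n \<and> W $$ (i, j) > 0}"

definition decentlam_g ::
  "nat \<Rightarrow> real mat \<Rightarrow> (nat \<Rightarrow> 'a::real_inner \<Rightarrow> real) \<Rightarrow> real \<Rightarrow> (nat \<Rightarrow> 'a) \<Rightarrow> nat \<Rightarrow> 'a" where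
  "decentlam_g n W f \<gamma> x i =
     (1 / \<gamma>) *\<^sub>R x i
     - (1 / \<gamma>) *\<^sub>R (\<Sum>j\<in>neighbours n W i. W $$ (i, j) *\<^sub>R (x j - \<gamma> *\<^sub>R grad (f j) (x j)))"

(* The pair (x, m) of iterates; only the components i < n are meaningful. *)
primrec decentlam ::
  "nat \<Rightarrow> real mat \<Rightarrow> (nat \<Rightarrow> 'a::real_inner \<Rightarrow> real) \<Rightarrow> real \<Rightarrow> real \<Rightarrow> (nat \<Rightarrow> 'a) \<Rightarrow>
   nat \<Rightarrow> (nat \<Rightarrow> 'a) \<times> (nat \<Rightarrow> 'a)" where
  "decentlam n W f \<gamma> \<beta> x0 0 = (x0, \<lambda>i. 0)"
| "decentlam n W f \<gamma> \<beta> x0 (Suc k) =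
     (let (x, m) = decentlam n W f \<gamma> \<beta> x0 k;
          m' = (\<lambda>i. \<beta> *\<^sub>R m i + decentlam_g n W f \<gamma> x i)
      in (\<lambda>i. x i - \<gamma> *\<^sub>R m' i, m'))"

definition decentlam_x ::
  "nat \<Rightarrow> real mat \<Rightarrow> (nat \<Rightarrow> 'a::real_inner \<Rightarrow> real) \<Rightarrow> real \<Rightarrow> real \<Rightarrow> (nat \<Rightarrow> 'a) \<Rightarrow>
   nat \<Rightarrow> nat \<Rightarrow> 'a" where
  "decentlam_x n W f \<gamma> \<beta> x0 k i = fst (decentlam n W f \<gamma> \<beta> x0 k) i"

definition avg_fun :: "nat \<Rightarrow> (nat \<Rightarrow> 'a \<Rightarrow> real) \<Rightarrow> 'a \<Rightarrow> real" where
  "avg_fun n f x = (1 / real n) * (\<Sum>i<n. f i x)"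

definition data_inconsistency_sq ::
  "nat \<Rightarrow> (nat \<Rightarrow> 'a::real_inner \<Rightarrow> real) \<Rightarrow> 'a \<Rightarrow> real" where
  "data_inconsistency_sq n f x = (1 / real n) * (\<Sum>i<n. (norm (grad (f i) x))\<^sup>2)"

end

theory Submission
  imports Defs
begin

text \<open>
  Eliminating the momentum, the iterates satisfy
  x(k+2) = W (x(k+1) - \<gamma> F(x(k+1))) + \<beta> (x(k+1) - x(k)) with F the stacked gradient. For small \<gamma> a
  quadratic energy of the increments x(k+1) - x(k) decays geometrically: its decrease needs only that
  W is symmetric and nonexpansive, and strong convexity supplies the decay in the consensus direction.
  Hence the iterates converge to a fixed point y = W (y - \<gamma> F(y)). Pairing the fixed point equation
  with the deviation z of y from its average gives (1 - \<rho>) |z| \<le> \<gamma> |F(y)|; since the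
  components of F(y) sum to zero, strong convexity bounds the distance of the average to the
  minimizer by (L / \<mu>) |z|, and the two estimates combine to the bias bound.

  The gap <z, W z> \<le> \<rho> |z|^2 for z with zero sum comes from an orthonormal eigenbasis ordered by
  decreasing eigenvalue; \<rho> < 1 because the forms sum w(i,j) (x(i) - x(j))^2 and
  sum w(i,j) (x(i) + x(j))^2 vanish only on constants and at 0, respectively.
\<close>

subsection \<open>Stacked vectors and the spectral theorem\<close>

text \<open>The operator W F need not be monotone. For a gradient difference h belonging to an
  increment e, strong convexity bounds <h, e> from below, but the recursion supplies <W h, e>. The
  discrepancy <h, (I - W) e> is at most L |e| |(I - W) e|, which is why the energy has to lose a
  multiple of |(I - W) e|^2 in every step. Increments are followed, rather than distances to a
  limit, because no fixed point is known beforehand: their summability produces one. The bias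
  estimate feeds back on itself: |F(y)| is at most |F| at the minimizer plus L times the distance of
  y from the minimizer. The second part is absorbed once \<gamma> is below a multiple of 1 - \<rho>.
  So there are two thresholds for \<gamma>, one in \<beta> and one in \<rho>, while the constant in
  the bias is free of both: the momentum term cancels from the fixed point equation.\<close>

definition stack_inner :: "nat \<Rightarrow> (nat \<Rightarrow> 'a::real_inner) \<Rightarrow> (nat \<Rightarrow> 'a) \<Rightarrow> real" where
  "stack_inner n x y = (\<Sum>i<n. inner (x i) (y i))"

text \<open>Stacks are functions on all of \<open>nat\<close> of which only the entries below
  \<open>n\<close> count, so no type of n-tuples has to be fixed. \<open>L2_set\<close> supplies
  Minkowski and Cauchy-Schwarz.\<close>

definition stack_norm :: "nat \<Rightarrow> (nat \<Rightarrow> 'a::real_inner) \<Rightarrow> real" where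
  "stack_norm n x = L2_set (\<lambda>i. norm (x i)) {..<n}"

text \<open>The Kronecker product of \<open>w\<close> with the identity of \<open>'a\<close>, acting
  on stacks.\<close>

definition mix :: "nat \<Rightarrow> (nat \<Rightarrow> nat \<Rightarrow> real) \<Rightarrow> (nat \<Rightarrow> 'a::real_vector) \<Rightarrow> nat \<Rightarrow> 'a" where
  "mix n w x i = (\<Sum>j<n. w i j *\<^sub>R x j)"

lemma stack_inner_commute: "stack_inner n x y = stack_inner n y x"
  by (simp add: stack_inner_def inner_commute)

lemma stack_inner_add_left:
  "stack_inner n (\<lambda>i. x i + y i) z = stack_inner n x z + stack_inner n y z"
  by (simp add: stack_inner_def inner_add_left sum.distrib)

lemma stack_inner_add_right:
  "stack_inner n z (\<lambda>i. x i + y i) = stack_inner n z x + stack_inner n z y"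
  by (simp add: stack_inner_def inner_add_right sum.distrib)

lemma stack_inner_diff_left:
  "stack_inner n (\<lambda>i. x i - y i) z = stack_inner n x z - stack_inner n y z"
  by (simp add: stack_inner_def inner_diff_left sum_subtractf)

lemma stack_inner_diff_right:
  "stack_inner n z (\<lambda>i. x i - y i) = stack_inner n z x - stack_inner n z y"
  by (simp add: stack_inner_def inner_diff_right sum_subtractf)

lemma stack_inner_scaleR_left:
  "stack_inner n (\<lambda>i. c *\<^sub>R x i) z = c * stack_inner n x z"
  by (simp add: stack_inner_def sum_distrib_left)

lemma stack_inner_scaleR_right:
  "stack_inner n z (\<lambda>i. c *\<^sub>R x i) = c * stack_inner n z x"
  by (simp add: stack_inner_def sum_distrib_left)

lemmas stack_inner_simps =
  stack_inner_add_left stack_inner_add_right stack_inner_diff_left stack_inner_diff_right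
  stack_inner_scaleR_left stack_inner_scaleR_right

lemma stack_inner_cong:
  assumes "\<And>i. i < n \<Longrightarrow> x i = x' i" "\<And>i. i < n \<Longrightarrow> y i = y' i"
  shows "stack_inner n x y = stack_inner n x' y'"
  using assms by (simp add: stack_inner_def)

lemma stack_norm_nonneg [simp]: "0 \<le> stack_norm n x"
  by (simp add: stack_norm_def L2_set_nonneg)

lemma stack_norm_power2: "(stack_norm n x)\<^sup>2 = (\<Sum>i<n. (norm (x i))\<^sup>2)"
  unfolding stack_norm_def L2_set_def by (simp add: sum_nonneg)

lemma stack_inner_self: "stack_inner n x x = (stack_norm n x)\<^sup>2"
  by (simp add: stack_norm_power2 stack_inner_def power2_norm_eq_inner)

lemma norm_le_stack_norm: "i < n \<Longrightarrow> norm (x i) \<le> stack_norm n x"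
  unfolding stack_norm_def by (rule member_le_L2_set) auto

lemma stack_norm_eq_0_iff: "stack_norm n x = 0 \<longleftrightarrow> (\<forall>i<n. x i = 0)"
  by (auto simp: stack_norm_def L2_set_eq_0_iff)

lemma stack_norm_scaleR: "stack_norm n (\<lambda>i. c *\<^sub>R x i) = \<bar>c\<bar> * stack_norm n x"
  by (simp add: stack_norm_def L2_set_right_distrib)

lemma stack_norm_triangle: "stack_norm n (\<lambda>i. x i + y i) \<le> stack_norm n x + stack_norm n y"
proof -
  have "stack_norm n (\<lambda>i. x i + y i) \<le> L2_set (\<lambda>i. norm (x i) + norm (y i)) {..<n}"
    unfolding stack_norm_def by (rule L2_set_mono) (auto intro: norm_triangle_ineq)
  also have "\<dots> \<le> stack_norm n x + stack_norm n y"
    unfolding stack_norm_def by (rule L2_set_triangle_ineq)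
  finally show ?thesis .
qed

lemma stack_norm_triangle_diff: "stack_norm n (\<lambda>i. x i - y i) \<le> stack_norm n x + stack_norm n y"
  using stack_norm_triangle[of n x "\<lambda>i. - y i"] by (simp add: stack_norm_def)

lemma stack_inner_Cauchy_Schwarz: "\<bar>stack_inner n x y\<bar> \<le> stack_norm n x * stack_norm n y"
proof -
  have "\<bar>stack_inner n x y\<bar> \<le> (\<Sum>i<n. \<bar>inner (x i) (y i)\<bar>)"
    unfolding stack_inner_def by (rule sum_abs)
  also have "\<dots> \<le> (\<Sum>i<n. \<bar>norm (x i)\<bar> * \<bar>norm (y i)\<bar>)"
    by (intro sum_mono) (simp add: Cauchy_Schwarz_ineq2)
  also have "\<dots> \<le> stack_norm n x * stack_norm n y"
    unfolding stack_norm_def by (rule L2_set_mult_ineq)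
  finally show ?thesis .
qed

lemma stack_norm_Lipschitz:
  assumes "\<And>i. i < n \<Longrightarrow> norm (x i) \<le> c * norm (y i)" "0 \<le> c"
  shows "stack_norm n x \<le> c * stack_norm n y"
proof -
  have "stack_norm n x \<le> L2_set (\<lambda>i. c * norm (y i)) {..<n}"
    unfolding stack_norm_def using assms by (intro L2_set_mono) auto
  also have "\<dots> = c * stack_norm n y"
    using assms(2) by (simp add: stack_norm_def L2_set_right_distrib)
  finally show ?thesis .
qed

lemma mix_cong: "(\<And>j. j < n \<Longrightarrow> x j = y j) \<Longrightarrow> mix n w x = mix n w y"
  by (simp add: mix_def fun_eq_iff)

lemma mix_add: "mix n w (\<lambda>j. x j + y j) = (\<lambda>i. mix n w x i + mix n w y i)"
  by (simp add: mix_def fun_eq_iff scaleR_add_right sum.distrib)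

lemma mix_diff: "mix n w (\<lambda>j. x j - y j) = (\<lambda>i. mix n w x i - mix n w y i)"
  by (simp add: mix_def fun_eq_iff scaleR_diff_right sum_subtractf)

lemma mix_scaleR: "mix n w (\<lambda>j. c *\<^sub>R x j) = (\<lambda>i. c *\<^sub>R mix n w x i)"
  by (simp add: mix_def fun_eq_iff scaleR_sum_right mult.commute)

lemma stack_inner_mix_symmetric:
  assumes "\<And>i j. i < n \<Longrightarrow> j < n \<Longrightarrow> w i j = w j i"
  shows "stack_inner n (mix n w x) y = stack_inner n x (mix n w y)"
proof -
  have "stack_inner n (mix n w x) y = (\<Sum>i<n. \<Sum>j<n. w i j * inner (x j) (y i))"
    by (simp add: stack_inner_def mix_def inner_sum_left)
  also have "\<dots> = (\<Sum>j<n. \<Sum>i<n. w i j * inner (x j) (y i))"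
    by (rule sum.swap)
  also have "\<dots> = stack_inner n x (mix n w y)"
    using assms by (simp add: stack_inner_def mix_def inner_sum_right)
  finally show ?thesis .
qed

section \<open>Orthonormal eigenbases of symmetric matrices\<close>

lemma compact_bounded_stacks: "compact {v :: nat \<Rightarrow> real. \<forall>i. v i \<in> (if i < n then {-1..1} else {0})}"
proof -
  \<comment> \<open>Tychonoff: the function space carries the product topology, and the entries from
    \<open>n\<close> on are pinned to 0.\<close>
  have "compactin (product_topology (\<lambda>i. euclidean) UNIV)
          (PiE UNIV (\<lambda>i. if i < n then {-1..1::real} else {0}))"
    by (subst compactin_PiE) auto
  then show ?thesis
    by (simp add: euclidean_product_topology PiE_def Pi_def)
qed

lemma continuous_on_stack_inner:
  fixes x y :: "'b::topological_space \<Rightarrow> nat \<Rightarrow> real"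
  assumes "continuous_on S x" "continuous_on S y"
  shows "continuous_on S (\<lambda>s. stack_inner n (x s) (y s))"
  unfolding stack_inner_def
  by (intro continuous_on_sum continuous_on_inner
      assms[THEN continuous_on_product_then_coordinatewise])

text \<open>Fewer than \<open>n\<close> linear conditions: padded with zero rows they form a square
  matrix whose row \<open>k\<close> vanishes, so it is singular and has a nonzero kernel
  vector.\<close>

lemma exists_orthogonal_stack:
  fixes p :: "nat \<Rightarrow> nat \<Rightarrow> real"
  assumes "k < n"
  obtains v :: "nat \<Rightarrow> real" where "stack_norm n v > 0" "\<And>j. j < k \<Longrightarrow> stack_inner n (p j) v = 0"
proof -
  define M where "M = mat n n (\<lambda>(i, j). if i < k then p i j else 0)"
  have M: "M \<in> carrier_mat n n"
    by (simp add: M_def)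
  have "M = mat\<^sub>r n n (\<lambda>i. if i = k then 0\<^sub>v n else row M i)"
    by (rule eq_matI) (auto simp: M_def)
  then have "det M = 0"
    using det_row_0[OF assms, of "\<lambda>i. row M i"] M by auto
  then obtain u where u: "u \<in> carrier_vec n" "u \<noteq> 0\<^sub>v n" "M *\<^sub>v u = 0\<^sub>v n"
    using det_0_iff_vec_prod_zero[OF M] by blast
  have "\<exists>i<n. vec_index u i \<noteq> 0"
  proof (rule ccontr)
    assume "\<not> ?thesis"
    then have "u = 0\<^sub>v n"
      using u(1) by (intro eq_vecI) auto
    with u(2) show False ..
  qed
  then have "stack_norm n (vec_index u) \<noteq> 0"
    by (auto simp: stack_norm_eq_0_iff)
  then have pos: "stack_norm n (vec_index u) > 0"
    using stack_norm_nonneg[of n "vec_index u"] by linarith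
  have "stack_inner n (p j) (vec_index u) = 0" if "j < k" for j
  proof -
    have "vec_index (M *\<^sub>v u) j = 0"
      using u(3) that assms by simp
    then show ?thesis
      using that assms u(1) by (simp add: M_def scalar_prod_def stack_inner_def atLeast0LessThan)
  qed
  with pos that show thesis by blast
qed

text \<open>Maximising the Rayleigh quotient orthogonally to the eigenvectors already found.\<close>

lemma next_eigenvector:
  fixes w :: "nat \<Rightarrow> nat \<Rightarrow> real" and p :: "nat \<Rightarrow> nat \<Rightarrow> real"
  assumes sym: "\<And>i j. i < n \<Longrightarrow> j < n \<Longrightarrow> w i j = w j i" and "k < n"
    and eig: "\<And>j i. j < k \<Longrightarrow> i < n \<Longrightarrow> mix n w (p j) i = d j * p j i"
  obtains v c where "stack_inner n v v = 1" "\<And>j. j < k \<Longrightarrow> stack_inner n (p j) v = 0"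
    "\<And>i. i < n \<Longrightarrow> mix n w v i = c * v i"
    "\<And>u. (\<And>j. j < k \<Longrightarrow> stack_inner n (p j) u = 0) \<Longrightarrow>
      stack_inner n u (mix n w u) \<le> c * stack_inner n u u"
proof -
  define K where "K = {v :: nat \<Rightarrow> real. \<forall>i. v i \<in> (if i < n then {-1..1} else {0})}"
  define S where "S = {v. stack_inner n v v = 1} \<inter> (\<Inter>j\<in>{..<k}. {v. stack_inner n (p j) v = 0})"
  \<comment> \<open>Scaling alone need not lead into \<open>K\<close>, whose members vanish from
    \<open>n\<close> on; those entries are cut off as well, which no inner product notices.\<close>
  have normalize: "\<exists>v\<in>K \<inter> S. \<forall>i<n. u i = stack_norm n u * v i"
    if u: "stack_norm n u > 0" "\<And>j. j < k \<Longrightarrow> stack_inner n (p j) u = 0" for u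
  proof
    define v where "v = (\<lambda>i. if i < n then (1 / stack_norm n u) *\<^sub>R u i else 0)"
    show "\<forall>i<n. u i = stack_norm n u * v i"
      using u by (simp add: v_def)
    have v: "stack_inner n q v = (1 / stack_norm n u) * stack_inner n q u" for q
      by (subst stack_inner_scaleR_right[symmetric]) (auto simp: v_def intro: stack_inner_cong)
    have "stack_inner n v v = (1 / stack_norm n u) * stack_inner n v u"
      by (rule v)
    also have "\<dots> = (1 / stack_norm n u) * ((1 / stack_norm n u) * stack_inner n u u)"
      by (simp only: stack_inner_commute[of n v u] v)
    finally have "stack_inner n v v = 1"
      using u by (simp add: stack_inner_self power2_eq_square)
    moreover have "\<bar>v i\<bar> \<le> 1" if "i < n" for i
      using norm_le_stack_norm[OF that, of u] that u(1) by (simp add: v_def)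
    moreover have "v i = 0" if "\<not> i < n" for i
      using that by (simp add: v_def)
    ultimately show "v \<in> K \<inter> S"
      using u(2) by (auto simp: K_def S_def v abs_le_iff minus_le_iff)
  qed
  have "closed {v :: nat \<Rightarrow> real. stack_inner n v v = 1}"
    by (intro closed_Collect_eq continuous_on_const
        continuous_on_stack_inner[OF continuous_on_id continuous_on_id])
  moreover have "closed {v. stack_inner n (p j) v = 0}" for j
    by (intro closed_Collect_eq continuous_on_const
        continuous_on_stack_inner[OF continuous_on_const continuous_on_id])
  ultimately have "closed S"
    unfolding S_def by (intro closed_Int closed_INT ballI)
  then have "compact (K \<inter> S)"
    using compact_bounded_stacks[of n] unfolding K_def[symmetric] by (simp add: compact_Int_closed)
  moreover obtain u where "stack_norm n u > 0" "\<And>j. j < k \<Longrightarrow> stack_inner n (p j) u = 0"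
    using exists_orthogonal_stack[OF \<open>k < n\<close>] by metis
  then have "K \<inter> S \<noteq> {}"
    using normalize by blast
  moreover have "continuous_on (K \<inter> S) (\<lambda>v. stack_inner n v (mix n w v))"
    unfolding mix_def
    by (intro continuous_on_stack_inner[OF continuous_on_id] continuous_on_coordinatewise_then_product
        continuous_on_sum continuous_on_scaleR continuous_on_const
        continuous_on_subset[OF continuous_on_product_coordinates subset_UNIV])
  ultimately obtain v where "v \<in> K \<inter> S"
    and max: "\<And>y. y \<in> K \<inter> S \<Longrightarrow> stack_inner n y (mix n w y) \<le> stack_inner n v (mix n w v)"
    using continuous_attains_sup[of "K \<inter> S" "\<lambda>v. stack_inner n v (mix n w v)"] by blast
  define c where "c = stack_inner n v (mix n w v)"
  have v: "stack_inner n v v = 1" "\<And>j. j < k \<Longrightarrow> stack_inner n (p j) v = 0"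
    using \<open>v \<in> K \<inter> S\<close> by (auto simp: S_def)
  have bound: "stack_inner n u (mix n w u) \<le> c * stack_inner n u u"
    if orth: "\<And>j. j < k \<Longrightarrow> stack_inner n (p j) u = 0" for u
  proof (cases "stack_norm n u = 0")
    case True
    then have "stack_inner n u q = 0" for q
      using stack_inner_Cauchy_Schwarz[of n u q] by simp
    then show ?thesis by simp
  next
    case False
    then have pos: "stack_norm n u > 0"
      using stack_norm_nonneg[of n u] by linarith
    then obtain y where y: "y \<in> K \<inter> S" "\<And>i. i < n \<Longrightarrow> u i = stack_norm n u *\<^sub>R y i"
      using normalize[OF pos orth] by auto
    have "mix n w u = mix n w (\<lambda>i. stack_norm n u *\<^sub>R y i)"
      by (rule mix_cong) (use y in auto)
    then have "stack_inner n u (mix n w u)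
        = stack_inner n (\<lambda>i. stack_norm n u *\<^sub>R y i) (\<lambda>i. stack_norm n u *\<^sub>R mix n w y i)"
      unfolding mix_scaleR by (intro stack_inner_cong) (use y in auto)
    also have "\<dots> = (stack_norm n u)\<^sup>2 * stack_inner n y (mix n w y)"
      unfolding stack_inner_scaleR_left stack_inner_scaleR_right by (simp add: power2_eq_square)
    also have "\<dots> \<le> (stack_norm n u)\<^sup>2 * c"
      using max[OF y(1)] by (intro mult_left_mono) (auto simp: c_def)
    finally show ?thesis
      by (simp add: stack_inner_self mult.commute)
  qed
  \<comment> \<open>The maximiser is an eigenvector as soon as this residual vanishes.
    Self-adjointness keeps \<open>r\<close> orthogonal to the earlier eigenvectors, so
    \<open>v + t r\<close> may be inserted into the Rayleigh bound.\<close>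
  define r where "r = (\<lambda>i. mix n w v i - c *\<^sub>R v i)"
  have "stack_inner n (p j) r = 0" if "j < k" for j
  proof -
    have "stack_inner n (p j) (mix n w v) = stack_inner n (mix n w (p j)) v"
      by (rule stack_inner_mix_symmetric[symmetric, OF sym])
    also have "\<dots> = stack_inner n (\<lambda>i. d j *\<^sub>R p j i) v"
      by (rule stack_inner_cong) (use eig that in auto)
    finally show ?thesis
      using v(2)[OF that] by (simp only: r_def stack_inner_simps)
  qed
  note r_orth = this
  define R where "R = stack_inner n r r"
  define Q where "Q = stack_inner n r (mix n w r)"
  have first_order: "2 * t * R \<le> t\<^sup>2 * (c * R - Q)" for t
  proof -
    define u where "u = (\<lambda>i. v i + t *\<^sub>R r i)"
    have "stack_inner n (p j) u = 0" if "j < k" for j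
      unfolding u_def stack_inner_add_right stack_inner_scaleR_right
      using v(2)[OF that] r_orth[OF that] by simp
    then have bound_u: "stack_inner n u (mix n w u) \<le> c * stack_inner n u u"
      by (rule bound)
    have "stack_inner n v (mix n w r) = stack_inner n r (mix n w v)"
      by (subst stack_inner_commute) (rule stack_inner_mix_symmetric[OF sym])
    moreover have "stack_inner n r (mix n w v) = R + c * stack_inner n r v"
    proof -
      have "R = stack_inner n r (\<lambda>i. mix n w v i - c *\<^sub>R v i)"
        by (simp only: R_def r_def)
      then show ?thesis
        unfolding stack_inner_diff_right stack_inner_scaleR_right by simp
    qed
    ultimately have "stack_inner n u (mix n w u) = c + 2 * t * (R + c * stack_inner n r v) + t\<^sup>2 * Q"
      unfolding u_def mix_add mix_scaleR stack_inner_simps Q_def[symmetric] c_def[symmetric]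
      by (simp add: power2_eq_square distrib_left)
    moreover have "stack_inner n u u = 1 + 2 * t * stack_inner n r v + t\<^sup>2 * R"
      unfolding u_def stack_inner_simps R_def[symmetric] v stack_inner_commute[of n v r]
      by (simp add: power2_eq_square distrib_left)
    ultimately have "c + 2 * t * (R + c * stack_inner n r v) + t\<^sup>2 * Q
        \<le> c * (1 + 2 * t * stack_inner n r v + t\<^sup>2 * R)"
      using bound_u by simp
    then show ?thesis
      by (simp add: algebra_simps)
  qed
  have "R = 0"
  proof (rule ccontr)
    assume "R \<noteq> 0"
    then have R: "R > 0"
      unfolding R_def stack_inner_self by simp
    define M where "M = \<bar>c * R - Q\<bar> + 1"
    have M: "M > 0" "c * R - Q \<le> M"
      by (auto simp: M_def)
    \<comment> \<open>For small t > 0 the linear term beats the quadratic one: t = R / M already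
      leads to 2 R^2 / M \<le> R^2 / M.\<close>
    have "2 * (R / M) * R \<le> (R / M)\<^sup>2 * (c * R - Q)"
      by (rule first_order)
    also have "\<dots> \<le> (R / M)\<^sup>2 * M"
      using M by (intro mult_left_mono) auto
    finally show False
      using R M(1) by (simp add: power2_eq_square field_simps)
  qed
  then have ev: "mix n w v i = c * v i" if "i < n" for i
    using that by (simp add: R_def stack_inner_self stack_norm_eq_0_iff r_def)
  show thesis
    by (rule that[OF v ev bound])
qed

text \<open>Iterates \<open>next_eigenvector\<close>. The third conclusion is half of
  Courant-Fischer and is used twice: tested on a later eigenvector it shows that \<open>d\<close>
  decreases, and at \<open>k = 1\<close> it yields the spectral gap.\<close>

lemma orthonormal_eigenbasis:
  fixes w :: "nat \<Rightarrow> nat \<Rightarrow> real"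
  assumes sym: "\<And>i j. i < n \<Longrightarrow> j < n \<Longrightarrow> w i j = w j i"
  obtains p d where
    "\<And>j k. j < n \<Longrightarrow> k < n \<Longrightarrow> stack_inner n (p j) (p k) = (if j = k then 1 else 0)"
    "\<And>k i. k < n \<Longrightarrow> i < n \<Longrightarrow> mix n w (p k) i = d k * p k i"
    "\<And>k u. k < n \<Longrightarrow> (\<And>j. j < k \<Longrightarrow> stack_inner n (p j) u = 0) \<Longrightarrow>
      stack_inner n u (mix n w u) \<le> d k * stack_inner n u u"
proof -
  define good where "good p d k \<longleftrightarrow>
      stack_inner n (p k) (p k) = 1 \<and> (\<forall>j<k. stack_inner n (p j) (p k) = 0) \<and>
      (\<forall>i<n. mix n w (p k) i = d k * p k i) \<and>
      (\<forall>u. (\<forall>j<k. stack_inner n (p j) u = 0) \<longrightarrow>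
        stack_inner n u (mix n w u) \<le> d k * stack_inner n u u)"
    for p :: "nat \<Rightarrow> nat \<Rightarrow> real" and d k
  have "\<exists>p d. \<forall>k<m. good p d k" if "m \<le> n" for m
    using that
  proof (induction m)
    case 0
    show ?case by simp
  next
    case (Suc m)
    then obtain p d where IH: "\<And>k. k < m \<Longrightarrow> good p d k"
      by auto
    have eig: "mix n w (p j) i = d j * p j i" if "j < m" "i < n" for j i
      using IH[OF that(1)] that(2) by (simp add: good_def)
    have "m < n"
      using Suc.prems by simp
    obtain v c where v: "stack_inner n v v = 1" "\<And>j. j < m \<Longrightarrow> stack_inner n (p j) v = 0"
      "\<And>i. i < n \<Longrightarrow> mix n w v i = c * v i"
      "\<And>u. (\<And>j. j < m \<Longrightarrow> stack_inner n (p j) u = 0) \<Longrightarrow>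
        stack_inner n u (mix n w u) \<le> c * stack_inner n u u"
      by (rule next_eigenvector[OF sym \<open>m < n\<close> eig]) auto
    \<comment> \<open>\<open>good\<close> at \<open>k\<close> reads \<open>p\<close> and
      \<open>d\<close> only up to \<open>k\<close>, so overwriting index \<open>m\<close> preserves
      it below \<open>m\<close>.\<close>
    have "good (p(m := v)) (d(m := c)) k" if "k < Suc m" for k
    proof (cases "k = m")
      case True
      with v show ?thesis by (simp add: good_def)
    next
      case False
      with that have "k < m" by simp
      with IH[OF this] show ?thesis by (simp add: good_def)
    qed
    then show ?case by blast
  qed
  from this[of n] obtain p d where good: "\<And>k. k < n \<Longrightarrow> good p d k"
    by auto
  show thesis
  proof (rule that)
    show "stack_inner n (p j) (p k) = (if j = k then 1 else 0)" if "j < n" "k < n" for j k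
      using good[OF that(1)] good[OF that(2)]
      by (cases j k rule: linorder_cases) (auto simp: good_def stack_inner_commute[of n "p j" "p k"])
    show "mix n w (p k) i = d k * p k i" if "k < n" "i < n" for k i
      using good[OF that(1)] that(2) by (simp add: good_def)
    show "stack_inner n u (mix n w u) \<le> d k * stack_inner n u u"
      if "k < n" "\<And>j. j < k \<Longrightarrow> stack_inner n (p j) u = 0" for k u
      using good[OF that(1)] that(2) by (simp add: good_def)
  qed
qed

section \<open>Ordered eigenvalues as roots of the characteristic polynomial\<close>

lemma char_poly_orthonormal_eigenbasis:
  fixes W :: "real mat"
  assumes W: "W \<in> carrier_mat n n"
    and orth: "\<And>j k. j < n \<Longrightarrow> k < n \<Longrightarrow> stack_inner n (p j) (p k) = (if j = k then 1 else 0)"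
    and eig: "\<And>k i. k < n \<Longrightarrow> i < n \<Longrightarrow> mix n (\<lambda>i j. W $$ (i, j)) (p k) i = d k * p k i"
  shows "char_poly W = (\<Prod>k\<leftarrow>[0..<n]. [:- d k, 1:])"
proof -
  \<comment> \<open>Eigenvectors as columns of \<open>P\<close> and as rows of \<open>Q\<close>:
    orthonormality says Q P = 1 and the eigenvalue equations say W P = P D, so \<open>W\<close> is
    similar to the diagonal \<open>D\<close>.\<close>
  define P where "P = mat n n (\<lambda>(i, k). p k i)"
  define Q where "Q = mat n n (\<lambda>(k, i). p k i)"
  define D where "D = mat n n (\<lambda>(i, k). if i = k then d k else 0)"
  have carr: "P \<in> carrier_mat n n" "Q \<in> carrier_mat n n" "D \<in> carrier_mat n n"
    by (auto simp: P_def Q_def D_def)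
  have QP: "Q * P = 1\<^sub>m n"
    using orth by (intro eq_matI) (auto simp: P_def Q_def scalar_prod_def stack_inner_def atLeast0LessThan)
  then have PQ: "P * Q = 1\<^sub>m n"
    using mat_mult_left_right_inverse carr by blast
  have "W * P = P * D"
  proof (rule eq_matI)
    fix i k assume "i < dim_row (P * D)" "k < dim_col (P * D)"
    then have ik: "i < n" "k < n"
      using carr by auto
    have "(W * P) $$ (i, k) = mix n (\<lambda>i j. W $$ (i, j)) (p k) i"
      using ik W by (simp add: P_def scalar_prod_def mix_def atLeast0LessThan)
    also have "\<dots> = d k * p k i"
      using eig ik by simp
    also have "\<dots> = (\<Sum>j<n. p j i * (if j = k then d k else 0))"
      using ik by (simp add: sum.delta' if_distrib cong: if_cong)
    also have "\<dots> = (P * D) $$ (i, k)"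
      using ik by (simp add: P_def D_def scalar_prod_def atLeast0LessThan)
    finally show "(W * P) $$ (i, k) = (P * D) $$ (i, k)" .
  qed (use W carr in auto)
  then have "W = P * D * Q"
    using W carr PQ by (metis assoc_mult_mat right_mult_one_mat)
  then have "similar_mat W D"
    unfolding similar_mat_def using carr W QP PQ by (intro exI[of _ P] exI[of _ Q] similar_mat_witI) auto
  then have "char_poly W = char_poly D"
    by (rule char_poly_similar)
  also have "\<dots> = (\<Prod>a\<leftarrow>diag_mat D. [:- a, 1:])"
    using carr by (intro char_poly_upper_triangular[of _ n]) (auto simp: D_def)
  also have "diag_mat D = map d [0..<n]"
    by (simp add: diag_mat_def D_def)
  finally show ?thesis
    by (simp add: comp_def)
qed

lemma proots_prod_linear_factors:
  fixes xs :: "'a::idom list"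
  shows "proots (\<Prod>x\<leftarrow>xs. [:- x, 1:]) = mset xs"
proof (induction xs)
  case (Cons x xs)
  have "(\<Prod>x\<leftarrow>xs. [:- x, 1:]) \<noteq> (0 :: 'a poly)"
    by (auto simp: prod_list_zero_iff)
  with Cons show ?case
    by (simp add: proots_mult del: mult_pCons_left)
qed simp

text \<open>Bridge to the definition by roots: a decreasing \<open>d\<close> is already the reversed
  sorted list of the roots with multiplicity. The shift turns a rank counted from 1 into an index
  counted from 0.\<close>

lemma nth_largest_eigenvalue_orthonormal_eigenbasis:
  fixes W :: "real mat"
  assumes W: "W \<in> carrier_mat n n"
    and orth: "\<And>j k. j < n \<Longrightarrow> k < n \<Longrightarrow> stack_inner n (p j) (p k) = (if j = k then 1 else 0)"
    and eig: "\<And>k i. k < n \<Longrightarrow> i < n \<Longrightarrow> mix n (\<lambda>i j. W $$ (i, j)) (p k) i = d k * p k i"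
    and decr: "\<And>j k. j \<le> k \<Longrightarrow> k < n \<Longrightarrow> d k \<le> d j"
    and "1 \<le> i" "i \<le> n"
  shows "nth_largest_eigenvalue W i = d (i - 1)"
proof -
  have "char_poly W = (\<Prod>x\<leftarrow>map d [0..<n]. [:- x, 1:])"
    using char_poly_orthonormal_eigenbasis[OF W orth eig] by (simp add: comp_def)
  then have "proots (char_poly W) = mset (rev (map d [0..<n]))"
    by (simp only: proots_prod_linear_factors mset_rev)
  moreover have "sorted (rev (map d [0..<n]))"
    by (subst sorted_wrt_rev) (auto simp: sorted_wrt_iff_nth_less intro: decr)
  ultimately have "rev (sorted_list_of_multiset (proots (char_poly W))) = map d [0..<n]"
    by (simp only: sorted_list_of_multiset_mset sorted_sort_id rev_rev_ident)
  then show ?thesis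
    using assms(5,6) by (simp add: nth_largest_eigenvalue_def)
qed

subsection \<open>Symmetric stochastic matrices\<close>

text \<open>What the energy argument uses. Connectivity and positive self-weights enter only through
  the spectral gap, which \<open>fixed_point_bias\<close> takes as its assumption
  \<open>gap\<close>.\<close>

locale mixing_matrix =
  fixes n :: nat and w :: "nat \<Rightarrow> nat \<Rightarrow> real"
  assumes symmetric: "\<And>i j. i < n \<Longrightarrow> j < n \<Longrightarrow> w i j = w j i"
    and nonneg: "\<And>i j. i < n \<Longrightarrow> j < n \<Longrightarrow> 0 \<le> w i j"
    and row_sum: "\<And>i. i < n \<Longrightarrow> (\<Sum>j<n. w i j) = 1"
begin

lemma mix_self_adjoint: "stack_inner n (mix n w x) y = stack_inner n x (mix n w y)"
  by (rule stack_inner_mix_symmetric) (rule symmetric)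

lemma mix_const: "i < n \<Longrightarrow> mix n w (\<lambda>_. c) i = c"
  by (simp add: mix_def scaleR_sum_left[symmetric] row_sum)

lemma sum_mix: "(\<Sum>i<n. mix n w x i) = (\<Sum>i<n. x i)"
proof -
  have "(\<Sum>i<n. mix n w x i) = (\<Sum>j<n. \<Sum>i<n. w i j *\<^sub>R x j)"
    unfolding mix_def by (rule sum.swap)
  also have "\<dots> = (\<Sum>j<n. \<Sum>i<n. w j i *\<^sub>R x j)"
    by (intro sum.cong) (auto simp: symmetric)
  also have "\<dots> = (\<Sum>j<n. x j)"
    by (simp add: scaleR_sum_left[symmetric] row_sum)
  finally show ?thesis .
qed

text \<open>A Dirichlet form in two stacks, so that one identity covers three cases: y = x gives the
  Laplacian form, y = -x the signless Laplacian form, and y = W x nonexpansiveness. Rows sum to 1 by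
  assumption, columns by symmetry.\<close>

lemma weighted_differences:
  "(\<Sum>i<n. \<Sum>j<n. w i j * (norm (y i - x j))\<^sup>2) =
    (stack_norm n y)\<^sup>2 + (stack_norm n x)\<^sup>2 - 2 * stack_inner n y (mix n w x)"
proof -
  have "(\<Sum>i<n. \<Sum>j<n. w i j * (norm (y i - x j))\<^sup>2) =
    (\<Sum>i<n. \<Sum>j<n. w i j * (norm (y i))\<^sup>2) + (\<Sum>i<n. \<Sum>j<n. w i j * (norm (x j))\<^sup>2)
      - 2 * (\<Sum>i<n. \<Sum>j<n. w i j * inner (y i) (x j))"
    by (simp add: power2_norm_eq_inner inner_diff_left inner_diff_right inner_commute
        distrib_left right_diff_distrib sum.distrib sum_subtractf sum_distrib_left mult.assoc
        mult.left_commute)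
  also have "(\<Sum>i<n. \<Sum>j<n. w i j * (norm (y i))\<^sup>2) = (stack_norm n y)\<^sup>2"
    by (simp add: stack_norm_power2 sum_distrib_right[symmetric] row_sum)
  also have "(\<Sum>i<n. \<Sum>j<n. w i j * (norm (x j))\<^sup>2) = (\<Sum>j<n. \<Sum>i<n. w j i * (norm (x j))\<^sup>2)"
    by (subst sum.swap) (intro sum.cong, auto simp: symmetric)
  also have "\<dots> = (stack_norm n x)\<^sup>2"
    by (simp add: stack_norm_power2 sum_distrib_right[symmetric] row_sum)
  also have "(\<Sum>i<n. \<Sum>j<n. w i j * inner (y i) (x j)) = stack_inner n y (mix n w x)"
    by (simp add: stack_inner_def mix_def inner_sum_right)
  finally show ?thesis .
qed

lemma stack_inner_mix_le: "2 * stack_inner n y (mix n w x) \<le> (stack_norm n y)\<^sup>2 + (stack_norm n x)\<^sup>2"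
proof -
  have "0 \<le> (\<Sum>i<n. \<Sum>j<n. w i j * (norm (y i - x j))\<^sup>2)"
    by (intro sum_nonneg mult_nonneg_nonneg) (auto simp: nonneg)
  then show ?thesis
    unfolding weighted_differences by simp
qed

lemma stack_norm_mix_le: "stack_norm n (mix n w x) \<le> stack_norm n x"
proof -
  have "(stack_norm n (mix n w x))\<^sup>2 \<le> (stack_norm n x)\<^sup>2"
    using stack_inner_mix_le[of "mix n w x" x] unfolding stack_inner_self by linarith
  then show ?thesis
    by (rule power2_le_imp_le) simp
qed

text \<open>Equality case of \<open>stack_inner_mix_le\<close>: a vanishing sum of nonnegative terms
  vanishes termwise. With y = x it makes eigenvectors for 1 constant along arcs; with y = -x and
  \<open>i = j\<close> it excludes the eigenvalue -1.\<close>

lemma equal_neighbours: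
  assumes "stack_norm n x = stack_norm n y" "stack_inner n y (mix n w x) = (stack_norm n x)\<^sup>2"
    and "i < n" "j < n" "w i j > 0"
  shows "y i = x j"
proof -
  have nn: "0 \<le> w i j * (norm (y i - x j))\<^sup>2" if "i < n" "j < n" for i j
    using nonneg that by simp
  have "(\<Sum>i<n. \<Sum>j<n. w i j * (norm (y i - x j))\<^sup>2) = 0"
    unfolding weighted_differences using assms(1,2) by simp
  then have "(\<Sum>j<n. w i j * (norm (y i - x j))\<^sup>2) = 0"
    using \<open>i < n\<close> by (subst (asm) sum_nonneg_eq_0_iff) (auto intro!: sum_nonneg nn)
  then have "w i j * (norm (y i - x j))\<^sup>2 = 0"
    using \<open>i < n\<close> \<open>j < n\<close> by (subst (asm) sum_nonneg_eq_0_iff) (auto intro!: nn)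
  with \<open>w i j > 0\<close> show ?thesis by simp
qed

end

lemma weight_matrix_mixing_matrix:
  assumes "weight_matrix n G W" "transpose_mat W = W" "W *\<^sub>v vec n (\<lambda>_. 1) = vec n (\<lambda>_. 1)"
  shows "mixing_matrix n (\<lambda>i j. W $$ (i, j))"
proof
  have W: "W \<in> carrier_mat n n"
    using assms(1) by (simp add: weight_matrix_def)
  show "W $$ (i, j) = W $$ (j, i)" if "i < n" "j < n" for i j
  proof -
    have "W $$ (i, j) = transpose_mat W $$ (i, j)"
      using assms(2) by simp
    then show ?thesis
      using W that by simp
  qed
  show "0 \<le> W $$ (i, j)" if "i < n" "j < n" for i j
  proof -
    have "if (j, i) \<in> parcs G \<or> i = j then W $$ (i, j) > 0 else W $$ (i, j) = 0"
      using assms(1) that unfolding weight_matrix_def by blast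
    then show ?thesis
      by (simp split: if_splits)
  qed
  show "(\<Sum>j<n. W $$ (i, j)) = 1" if "i < n" for i
  proof -
    have "(\<Sum>j<n. W $$ (i, j)) = vec_index (W *\<^sub>v vec n (\<lambda>_. 1)) i"
      using W that by (simp add: scalar_prod_def atLeast0LessThan)
    also have "\<dots> = 1"
      unfolding assms(3) using that by simp
    finally show ?thesis .
  qed
qed

section \<open>Spectral gap of a strongly connected network\<close>

lemma strongly_connected_constant:
  assumes "strongly_connected (with_proj G)" "pverts G = {..<n}"
    and step: "\<And>i j. i < n \<Longrightarrow> j < n \<Longrightarrow> (i, j) \<in> parcs G \<Longrightarrow> x i = x j"
    and "i < n" "j < n"
  shows "x i = x j"
proof -
  have "(i, j) \<in> rtrancl_on (verts (with_proj G)) (arcs_ends (with_proj G))"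
    using assms(1,2,4,5) by (auto simp: strongly_connected_def reachable_def)
  then show ?thesis
  proof (induction rule: rtrancl_on_induct)
    case (step y z)
    then have "(y, z) \<in> parcs G" "y < n" "z < n"
      using assms(2) by (auto simp: arcs_ends_def arc_to_ends_def)
    with step.IH assms(3) show ?case by metis
  qed simp
qed

text \<open>The eigenbasis consists of real stacks; since \<open>w\<close> acts on each coordinate
  separately, Rayleigh bounds for real stacks carry over to \<open>'a\<close>.\<close>

lemma stack_inner_mix_componentwise:
  fixes x :: "nat \<Rightarrow> 'a::euclidean_space"
  shows "stack_inner n x (mix n w x) =
    (\<Sum>b\<in>Basis. stack_inner n (\<lambda>i. inner (x i) b) (mix n w (\<lambda>i. inner (x i) b)))"
proof -
  have "stack_inner n x (mix n w x) = (\<Sum>i<n. \<Sum>b\<in>Basis. inner (x i) b * inner (mix n w x i) b)"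
    unfolding stack_inner_def by (intro sum.cong refl euclidean_inner)
  also have "\<dots> = (\<Sum>b\<in>Basis. \<Sum>i<n. inner (x i) b * inner (mix n w x i) b)"
    by (rule sum.swap)
  also have "\<dots> = (\<Sum>b\<in>Basis. stack_inner n (\<lambda>i. inner (x i) b) (mix n w (\<lambda>i. inner (x i) b)))"
    by (simp add: stack_inner_def mix_def inner_sum_left)
  finally show ?thesis .
qed

text \<open>Since \<open>p 0\<close> is constant, zero sum is orthogonality to \<open>p 0\<close>,
  and the Rayleigh bound with factor \<open>d 1\<close> applies in every coordinate. The rate is
  below 1 because -1 < \<open>d (n - 1)\<close> \<le> \<open>d 1\<close> < 1.\<close>

lemma mixing_rate_spectral_gap:
  fixes W :: "real mat"
  assumes "n \<ge> 2" and G: "strongly_connected (with_proj G)" "pverts G = {..<n}"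
    and W: "weight_matrix n G W" "transpose_mat W = W" "W *\<^sub>v vec n (\<lambda>_. 1) = vec n (\<lambda>_. 1)"
  shows "mixing_rate n W < 1"
    and "\<And>x :: nat \<Rightarrow> 'a::euclidean_space. (\<Sum>i<n. x i) = 0 \<Longrightarrow>
      stack_inner n x (mix n (\<lambda>i j. W $$ (i, j)) x) \<le> mixing_rate n W * (stack_norm n x)\<^sup>2"
proof -
  define w where "w = (\<lambda>i j. W $$ (i, j))"
  interpret mixing_matrix n w
    unfolding w_def by (rule weight_matrix_mixing_matrix[OF W])
  have carr: "W \<in> carrier_mat n n"
    using W(1) by (simp add: weight_matrix_def)
  have diag: "w i i > 0" if "i < n" for i
    using W(1) that by (auto simp: weight_matrix_def w_def)
  have arc: "w j i > 0" if "i < n" "j < n" "(i, j) \<in> parcs G" for i j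
    using W(1) that unfolding weight_matrix_def w_def by auto
  obtain p d where
    orth: "\<And>j k. j < n \<Longrightarrow> k < n \<Longrightarrow> stack_inner n (p j) (p k) = (if j = k then 1 else 0)"
    and eig: "\<And>k i. k < n \<Longrightarrow> i < n \<Longrightarrow> mix n w (p k) i = d k * p k i"
    and rayleigh: "\<And>k u. k < n \<Longrightarrow> (\<And>j. j < k \<Longrightarrow> stack_inner n (p j) u = 0) \<Longrightarrow>
      stack_inner n u (mix n w u) \<le> d k * stack_inner n u u"
    using orthonormal_eigenbasis[of n w, OF symmetric] by metis
  have norm_p: "stack_norm n (p k) = 1" if "k < n" for k
    using orth[OF that that] power2_eq_1_iff[of "stack_norm n (p k)"] stack_norm_nonneg[of n "p k"]
    by (auto simp: stack_inner_self)
  have inner_mix_p: "stack_inner n u (mix n w (p k)) = d k * stack_inner n u (p k)" if "k < n" for u k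
  proof -
    have "stack_inner n u (mix n w (p k)) = stack_inner n u (\<lambda>i. d k *\<^sub>R p k i)"
      by (rule stack_inner_cong) (use eig that in auto)
    then show ?thesis
      by (simp only: stack_inner_scaleR_right)
  qed
  \<comment> \<open>\<open>p k\<close> is orthogonal to every eigenvector before \<open>p j\<close>,
    hence it competes in the Rayleigh bound for \<open>d j\<close>.\<close>
  have decr: "d k \<le> d j" if "j \<le> k" "k < n" for j k
    using rayleigh[of j "p k"] that orth by (simp add: inner_mix_p)
  have d_le: "d k \<le> 1" if "k < n" for k
    using stack_inner_mix_le[of "p k" "p k"] that by (simp add: inner_mix_p orth norm_p)
  have d_gt: "d k > -1" if "k < n" for k
  proof (rule ccontr)
    assume "\<not> ?thesis"
    moreover have "\<bar>d k\<bar> \<le> 1"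
    proof -
      have "\<bar>d k\<bar> = \<bar>stack_inner n (p k) (mix n w (p k))\<bar>"
        using that by (simp add: inner_mix_p orth)
      also have "\<dots> \<le> stack_norm n (p k) * stack_norm n (mix n w (p k))"
        by (rule stack_inner_Cauchy_Schwarz)
      also have "\<dots> \<le> 1"
        using stack_norm_mix_le[of "p k"] that by (simp add: norm_p)
      finally show ?thesis .
    qed
    ultimately have "d k = -1"
      by simp
    \<comment> \<open>\<open>y\<close> and \<open>p k\<close> meet the equality case, and the
      positive self-weight permits the same index on both sides: - \<open>p k i\<close> =
      \<open>p k i\<close>.\<close>
    define y where "y = (\<lambda>i. (-1) *\<^sub>R p k i)"
    have "stack_norm n (p k) = stack_norm n y"
      unfolding y_def stack_norm_scaleR by simp
    moreover have "stack_inner n y (mix n w (p k)) = (stack_norm n (p k))\<^sup>2"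
      using that unfolding y_def stack_inner_scaleR_left
      by (simp add: inner_mix_p orth norm_p \<open>d k = -1\<close>)
    ultimately have "y i = p k i" if "i < n" for i
      using that that diag[OF that] by (rule equal_neighbours)
    then have "stack_norm n (p k) = 0"
      by (simp add: stack_norm_eq_0_iff y_def)
    with norm_p[OF that] show False by simp
  qed
  have const_p: "p k i = p k 0" if "k < n" "d k = 1" "i < n" for k i
  proof (rule strongly_connected_constant[OF G])
    have eq: "stack_inner n (p k) (mix n w (p k)) = (stack_norm n (p k))\<^sup>2"
      using that by (simp add: inner_mix_p orth norm_p)
    show "p k i = p k j" if "i < n" "j < n" "(i, j) \<in> parcs G" for i j
      using equal_neighbours[OF refl eq that(2,1) arc[OF that]] by simp
  qed (use that in auto)
  \<comment> \<open>At index 0 the Rayleigh bound has no orthogonality constraint, so the constant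
    stack may be tested.\<close>
  have "d 0 = 1"
  proof -
    have "stack_inner n (\<lambda>_. 1) (mix n w (\<lambda>_. 1 :: real)) = stack_inner n (\<lambda>_. 1) (\<lambda>_. 1 :: real)"
      by (rule stack_inner_cong) (auto simp: mix_const)
    then have "real n \<le> d 0 * real n"
      using rayleigh[of 0 "\<lambda>_. 1"] assms(1) by (simp add: stack_inner_def)
    then have "1 \<le> d 0"
      using assms(1) by simp
    then show ?thesis
      using d_le[of 0] assms(1) by simp
  qed
  define a where "a = p 0 0"
  have p0: "p 0 i = a" if "i < n" for i
    unfolding a_def by (rule const_p) (use that \<open>d 0 = 1\<close> in auto)
  then have inner_p0: "stack_inner n (p 0) u = a * (\<Sum>i<n. u i)" for u
    by (simp add: stack_inner_def sum_distrib_left)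
  \<comment> \<open>A second eigenvalue 1 would give two constant unit stacks, which cannot be
    orthogonal.\<close>
  have "d 1 < 1"
  proof (rule ccontr)
    assume "\<not> ?thesis"
    then have "d 1 = 1"
      using d_le[of 1] assms(1) by simp
    define b where "b = p 1 0"
    have p1: "p 1 i = b" if "i < n" for i
      unfolding b_def by (rule const_p) (use that \<open>d 1 = 1\<close> assms(1) in auto)
    then have "stack_inner n (p 0) (p 1) = a * (real n * b)"
      unfolding inner_p0 by simp
    then have "a = 0 \<or> b = 0"
      using orth[of 0 1] assms(1) by simp
    then have "stack_norm n (p 0) = 0 \<or> stack_norm n (p 1) = 0"
      using p0 p1 by (auto simp: stack_norm_eq_0_iff)
    then show False
      using norm_p[of 0] norm_p[of 1] assms(1) by simp
  qed
  have rate: "mixing_rate n W = max \<bar>d 1\<bar> \<bar>d (n - 1)\<bar>"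
    unfolding mixing_rate_def
    using nth_largest_eigenvalue_orthonormal_eigenbasis[OF carr orth eig[unfolded w_def] decr, of 2]
      nth_largest_eigenvalue_orthonormal_eigenbasis[OF carr orth eig[unfolded w_def] decr, of n] assms(1)
    by simp
  have "d (n - 1) \<le> d 1"
    using assms(1) by (intro decr) auto
  then show "mixing_rate n W < 1"
    unfolding rate using \<open>d 1 < 1\<close> d_gt[of 1] d_gt[of "n - 1"] assms(1)
    by (auto simp: abs_less_iff)
  show "stack_inner n x (mix n (\<lambda>i j. W $$ (i, j)) x) \<le> mixing_rate n W * (stack_norm n x)\<^sup>2"
    if "(\<Sum>i<n. x i) = 0" for x :: "nat \<Rightarrow> 'a"
  proof -
    have "stack_inner n x (mix n w x)
        = (\<Sum>b\<in>Basis. stack_inner n (\<lambda>i. inner (x i) b) (mix n w (\<lambda>i. inner (x i) b)))"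
      by (rule stack_inner_mix_componentwise)
    also have "\<dots> \<le> (\<Sum>b\<in>Basis. d 1 * stack_inner n (\<lambda>i. inner (x i) b) (\<lambda>i. inner (x i) b))"
    proof (intro sum_mono rayleigh)
      fix b :: 'a and j :: nat assume "j < 1"
      then show "stack_inner n (p j) (\<lambda>i. inner (x i) b) = 0"
        using that by (simp add: inner_p0 inner_sum_left[symmetric])
    qed (use assms(1) in simp)
    also have "\<dots> = d 1 * (\<Sum>i<n. \<Sum>b\<in>Basis. inner (x i) b * inner (x i) b)"
      unfolding stack_inner_def by (subst sum.swap) (simp add: sum_distrib_left)
    also have "\<dots> = d 1 * (stack_norm n x)\<^sup>2"
      by (simp only: euclidean_inner[symmetric] stack_norm_power2 power2_norm_eq_inner)
    also have "\<dots> \<le> mixing_rate n W * (stack_norm n x)\<^sup>2"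
      unfolding rate by (intro mult_right_mono) auto
    finally show ?thesis
      by (simp add: w_def)
  qed
qed

subsection \<open>Geometric decay of the heavy-ball energy\<close>

text \<open>
  Put B = W + \<beta> I. Along e' = B e - \<beta> m, the first two terms of the energy, which equal
  (1 + \<beta>) (|e|^2 + \<beta>^2 |m|^2) - 2 \<beta> <B e, m>, drop by exactly
  (1 - \<beta>) <((1 + \<beta>)^2 - B^2) e, e> \<ge> \<beta> (1 - \<beta>) |(I - W) e|^2. They are blind to consensus
  directions; the last term, with a weight small enough to be absorbed by this drop, adds the decay
  of e - m there.
\<close>

definition heavy_ball_energy ::
  "nat \<Rightarrow> (nat \<Rightarrow> nat \<Rightarrow> real) \<Rightarrow> real \<Rightarrow> (nat \<Rightarrow> 'a::real_inner) \<Rightarrow> (nat \<Rightarrow> 'a) \<Rightarrow> real" where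
  "heavy_ball_energy n w \<beta> e m =
     (1 + \<beta>) * (stack_norm n (\<lambda>i. e i - \<beta> *\<^sub>R m i))\<^sup>2
     + 2 * \<beta> * stack_inner n (\<lambda>i. e i - mix n w e i) m
     + \<beta> * (1 - \<beta>)\<^sup>2 / 4 * (stack_norm n (\<lambda>i. e i - m i))\<^sup>2"

text \<open>Half of \<kappa> (1 - \<beta>), where \<kappa> is the weight of the last energy term.
  The other half of the decay of |e - m|^2 pays for the cross term between |e| and |e - m|.\<close>

definition energy_rate :: "real \<Rightarrow> real" where
  "energy_rate \<beta> = \<beta> * (1 - \<beta>) ^ 3 / 8"

text \<open>Collects the coefficients of (\<gamma> L |e|)^2 that arise in
  \<open>energy_balance\<close>: 2 from the squared gradient term, at most 1 from the last energy
  term, and one summand from each of two Young inequalities.\<close>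

definition step_bound :: "real \<Rightarrow> real" where
  "step_bound \<beta> = 3 + 8 / (\<beta> * (1 - \<beta>)) + 4 / energy_rate \<beta>"

lemma stack_norm_cong: "(\<And>i. i < n \<Longrightarrow> x i = y i) \<Longrightarrow> stack_norm n x = stack_norm n y"
  unfolding stack_norm_def by (rule L2_set_cong) auto

lemma heavy_ball_energy_cong:
  assumes "\<And>i. i < n \<Longrightarrow> e i = e' i"
  shows "heavy_ball_energy n w \<beta> e m = heavy_ball_energy n w \<beta> e' m"
proof -
  have "mix n w e = mix n w e'"
    using assms by (rule mix_cong)
  then show ?thesis
    using assms unfolding heavy_ball_energy_def
    by (intro arg_cong2[of _ _ _ _ "(+)"] arg_cong2[of _ _ _ _ "(*)"] arg_cong2[of _ _ _ _ "(^)"]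
        refl stack_norm_cong stack_inner_cong) auto
qed

text \<open>Convexity of the square at \<open>a\<close> and b / (1 - \<beta>) with weights \<beta>
  and 1 - \<beta>.\<close>

lemma square_weighted_le:
  fixes a b \<beta> :: real
  assumes "0 \<le> \<beta>" "\<beta> < 1"
  shows "(\<beta> * a + b)\<^sup>2 \<le> \<beta> * a\<^sup>2 + b\<^sup>2 / (1 - \<beta>)"
proof -
  have "\<beta> * a\<^sup>2 + b\<^sup>2 / (1 - \<beta>) - (\<beta> * a + b)\<^sup>2 = \<beta> * ((1 - \<beta>) * a - b)\<^sup>2 / (1 - \<beta>)"
    using assms by (simp add: field_simps power2_eq_square)
  also have "\<dots> \<ge> 0"
    using assms by simp
  finally show ?thesis by simp
qed

lemma young_inequality:
  fixes a x y :: real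
  assumes "a > 0"
  shows "4 * x * y \<le> a * y\<^sup>2 + 4 * x\<^sup>2 / a"
proof -
  have "a * y\<^sup>2 + 4 * x\<^sup>2 / a - 4 * x * y = (a * y - 2 * x)\<^sup>2 / a"
    using assms by (simp add: field_simps power2_eq_square)
  also have "\<dots> \<ge> 0"
    using assms by simp
  finally show ?thesis by simp
qed

text \<open>Scalar bookkeeping with E = |e|, R = |(I - W) e|, N = |e - m|, and V, V' the first two
  energy terms before and after a step. Cross terms are paid from the drops in R^2 and N^2; what
  remains is of second order in \<gamma> and takes at most half of the first-order gain in
  E^2.\<close>

lemma energy_balance:
  fixes \<beta> \<gamma> \<mu> L E R N N' V V' :: real
  assumes \<beta>: "0 < \<beta>" "\<beta> < 1" and "0 < \<gamma>" "0 \<le> L" "0 \<le> E" "0 \<le> R" "0 \<le> N"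
    and V': "V' \<le> V - \<beta> * (1 - \<beta>) * R\<^sup>2 - 2 * \<gamma> * (1 - \<beta>\<^sup>2) * \<mu> * E\<^sup>2
      + 4 * \<gamma> * L * E * R + 4 * \<gamma> * L * E * N + 2 * (\<gamma> * L * E)\<^sup>2"
    and N': "0 \<le> N'" "N' \<le> \<beta> * N + (R + \<gamma> * L * E)"
    and \<gamma>: "\<gamma> * L\<^sup>2 * step_bound \<beta> \<le> (1 - \<beta>\<^sup>2) * \<mu>"
  shows "V' + \<beta> * (1 - \<beta>)\<^sup>2 / 4 * N'\<^sup>2
    \<le> V + \<beta> * (1 - \<beta>)\<^sup>2 / 4 * N\<^sup>2 - energy_rate \<beta> * N\<^sup>2 - \<gamma> * (1 - \<beta>\<^sup>2) * \<mu> * E\<^sup>2"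
proof -
  \<comment> \<open>With this weight, 2 \<kappa> / (1 - \<beta>) = \<beta> (1 - \<beta>) / 2 is
    exactly half of the available drop in R^2; Young's inequality for \<open>4 * Y * R\<close>
    spends the other half.\<close>
  define \<kappa> where "\<kappa> = \<beta> * (1 - \<beta>)\<^sup>2 / 4"
  define Y where "Y = \<gamma> * L * E"
  have Y: "0 \<le> Y"
    using assms by (simp add: Y_def)
  have \<kappa>: "0 < \<kappa>"
    using \<beta> by (simp add: \<kappa>_def)
  have rate: "0 < energy_rate \<beta>" "\<kappa> * (1 - \<beta>) = 2 * energy_rate \<beta>"
    using \<beta> by (auto simp: energy_rate_def \<kappa>_def power2_eq_square power3_eq_cube)
  have a: "0 < \<beta> * (1 - \<beta>) / 2" "\<beta> * (1 - \<beta>) / 2 \<le> 1"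
    using \<beta> mult_mono[of \<beta> 1 "1 - \<beta>" 1] by auto
  have "N'\<^sup>2 \<le> (\<beta> * N + (R + Y))\<^sup>2"
    using N' by (intro power_mono) (auto simp: Y_def)
  also have "\<dots> \<le> \<beta> * N\<^sup>2 + (R + Y)\<^sup>2 / (1 - \<beta>)"
    using \<beta> by (intro square_weighted_le) auto
  also have "(R + Y)\<^sup>2 \<le> 2 * R\<^sup>2 + 2 * Y\<^sup>2"
    using sum_squares_bound[of R Y] by (simp add: power2_sum)
  finally have "N'\<^sup>2 \<le> \<beta> * N\<^sup>2 + (2 * R\<^sup>2 + 2 * Y\<^sup>2) / (1 - \<beta>)"
    using \<beta> by (simp add: divide_right_mono)
  then have "\<kappa> * N'\<^sup>2 \<le> \<kappa> * (\<beta> * N\<^sup>2 + (2 * R\<^sup>2 + 2 * Y\<^sup>2) / (1 - \<beta>))"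
    using \<kappa> by (intro mult_left_mono) auto
  also have "\<dots> = \<kappa> * N\<^sup>2 - \<kappa> * (1 - \<beta>) * N\<^sup>2 + \<beta> * (1 - \<beta>) / 2 * R\<^sup>2 + \<beta> * (1 - \<beta>) / 2 * Y\<^sup>2"
    using \<beta> by (simp add: \<kappa>_def field_simps power2_eq_square)
  finally have 1: "\<kappa> * N'\<^sup>2 \<le> \<kappa> * N\<^sup>2 - 2 * energy_rate \<beta> * N\<^sup>2 + \<beta> * (1 - \<beta>) / 2 * R\<^sup>2
      + \<beta> * (1 - \<beta>) / 2 * Y\<^sup>2"
    by (simp only: rate)
  have 2: "\<beta> * (1 - \<beta>) / 2 * Y\<^sup>2 \<le> 1 * Y\<^sup>2"
    using a by (intro mult_right_mono) auto
  have 3: "4 * Y * R \<le> \<beta> * (1 - \<beta>) / 2 * R\<^sup>2 + 4 * Y\<^sup>2 / (\<beta> * (1 - \<beta>) / 2)"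
    by (rule young_inequality) (rule a)
  have 4: "4 * Y * N \<le> energy_rate \<beta> * N\<^sup>2 + 4 * Y\<^sup>2 / energy_rate \<beta>"
    by (rule young_inequality) (rule rate)
  have "3 * Y\<^sup>2 + 4 * Y\<^sup>2 / (\<beta> * (1 - \<beta>) / 2) + 4 * Y\<^sup>2 / energy_rate \<beta>
      = \<gamma> * E\<^sup>2 * (\<gamma> * L\<^sup>2 * step_bound \<beta>)"
    by (simp add: step_bound_def Y_def algebra_simps power2_eq_square)
  also have "\<dots> \<le> \<gamma> * E\<^sup>2 * ((1 - \<beta>\<^sup>2) * \<mu>)"
    using \<gamma> \<open>0 < \<gamma>\<close> by (intro mult_left_mono) auto
  finally have 5: "3 * Y\<^sup>2 + 4 * Y\<^sup>2 / (\<beta> * (1 - \<beta>) / 2) + 4 * Y\<^sup>2 / energy_rate \<beta>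
      \<le> \<gamma> * (1 - \<beta>\<^sup>2) * \<mu> * E\<^sup>2"
    by (simp only: mult_ac)
  have 6: "V' \<le> V - 2 * (\<beta> * (1 - \<beta>) / 2 * R\<^sup>2) - 2 * (\<gamma> * (1 - \<beta>\<^sup>2) * \<mu> * E\<^sup>2)
      + 4 * Y * R + 4 * Y * N + 2 * Y\<^sup>2"
    using V' by (simp add: Y_def mult.assoc)
  show ?thesis
    unfolding \<kappa>_def[symmetric] using 1 2 3 4 5 6 by linarith
qed

section \<open>Decay of the energy and summability of the increments\<close>

context mixing_matrix
begin

text \<open>I - W is positive semidefinite with norm at most 2, so its square is at most twice
  itself. Expanding the left side reduces this to |W e| \<le> |e|.\<close>

lemma residual_le: "(stack_norm n (\<lambda>i. e i - mix n w e i))\<^sup>2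
    \<le> 2 * stack_inner n e (\<lambda>i. e i - mix n w e i)"
proof -
  have "(stack_norm n (mix n w e))\<^sup>2 \<le> (stack_norm n e)\<^sup>2"
    by (intro power_mono stack_norm_mix_le) simp
  moreover have "(stack_norm n (\<lambda>i. e i - mix n w e i))\<^sup>2 =
      (stack_norm n e)\<^sup>2 - 2 * stack_inner n e (mix n w e) + (stack_norm n (mix n w e))\<^sup>2"
    unfolding stack_inner_self[symmetric] stack_inner_simps
    by (simp add: stack_inner_commute[of n "mix n w e" e])
  moreover have "stack_inner n e (\<lambda>i. e i - mix n w e i) = (stack_norm n e)\<^sup>2 - stack_inner n e (mix n w e)"
    unfolding stack_inner_self[symmetric] stack_inner_simps ..
  ultimately show ?thesis by linarith
qed

text \<open>In the application \<open>m\<close> is the increment preceding \<open>e\<close>, and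
  \<open>h\<close> the gradient difference across \<open>e\<close>. The change of energy is first
  computed exactly, and only the gradient terms and the residual are then estimated.\<close>

lemma heavy_ball_energy_step:
  assumes \<beta>: "0 < \<beta>" "\<beta> < 1" and "0 < \<gamma>" "0 \<le> L"
    and h: "stack_norm n h \<le> L * stack_norm n e" "\<mu> * (stack_norm n e)\<^sup>2 \<le> stack_inner n h e"
    and \<gamma>: "\<gamma> * L\<^sup>2 * step_bound \<beta> \<le> (1 - \<beta>\<^sup>2) * \<mu>"
    and e': "\<And>i. i < n \<Longrightarrow> e' i = mix n w (\<lambda>j. e j - \<gamma> *\<^sub>R h j) i + \<beta> *\<^sub>R (e i - m i)"
  shows "heavy_ball_energy n w \<beta> e' e \<le> heavy_ball_energy n w \<beta> e m
    - energy_rate \<beta> * (stack_norm n (\<lambda>i. e i - m i))\<^sup>2 - \<gamma> * (1 - \<beta>\<^sup>2) * \<mu> * (stack_norm n e)\<^sup>2"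
proof -
  define v where "v = (\<lambda>i. e i - m i)"
  define r where "r = (\<lambda>i. e i - mix n w e i)"
  define q where "q = mix n w h"
  define f where "f = (\<lambda>i. e i + \<beta> *\<^sub>R v i - r i - \<gamma> *\<^sub>R q i)"
  define E where "E = stack_norm n e"
  define R where "R = stack_norm n r"
  define N where "N = stack_norm n v"
  have nonneg: "0 \<le> E" "0 \<le> R" "0 \<le> N"
    by (simp_all add: E_def R_def N_def)
  have "e' i = f i" if "i < n" for i
    using e'[OF that] by (simp add: f_def r_def q_def v_def mix_diff mix_scaleR)
  then have energy_f: "heavy_ball_energy n w \<beta> e' e = heavy_ball_energy n w \<beta> f e"
    by (rule heavy_ball_energy_cong)
  have sa: "stack_inner n (\<lambda>i. f i - mix n w f i) e = stack_inner n f r"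
    unfolding r_def stack_inner_simps mix_self_adjoint ..
  define V where "V = (1 + \<beta>) * (stack_norm n (\<lambda>i. (1 - \<beta>) *\<^sub>R e i + \<beta> *\<^sub>R v i))\<^sup>2
    + 2 * \<beta> * stack_inner n r (\<lambda>i. e i - v i)"
  define V' where "V' = (1 + \<beta>) * (stack_norm n (\<lambda>i. (1 - \<beta>) *\<^sub>R e i + \<beta> *\<^sub>R v i - r i - \<gamma> *\<^sub>R q i))\<^sup>2
    + 2 * \<beta> * stack_inner n f r"
  define N' where "N' = stack_norm n (\<lambda>i. \<beta> *\<^sub>R v i - r i - \<gamma> *\<^sub>R q i)"
  have en: "heavy_ball_energy n w \<beta> e m = V + \<beta> * (1 - \<beta>)\<^sup>2 / 4 * N\<^sup>2"
  proof -
    have "(\<lambda>i. e i - \<beta> *\<^sub>R m i) = (\<lambda>i. (1 - \<beta>) *\<^sub>R e i + \<beta> *\<^sub>R v i)"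
      by (simp add: fun_eq_iff v_def algebra_simps)
    moreover have "m = (\<lambda>i. e i - v i)"
      by (simp add: v_def)
    ultimately show ?thesis
      unfolding heavy_ball_energy_def V_def N_def v_def[symmetric] r_def[symmetric] by simp
  qed
  have en': "heavy_ball_energy n w \<beta> f e = V' + \<beta> * (1 - \<beta>)\<^sup>2 / 4 * N'\<^sup>2"
  proof -
    have "(\<lambda>i. f i - \<beta> *\<^sub>R e i) = (\<lambda>i. (1 - \<beta>) *\<^sub>R e i + \<beta> *\<^sub>R v i - r i - \<gamma> *\<^sub>R q i)"
      by (simp add: fun_eq_iff f_def algebra_simps)
    moreover have "(\<lambda>i. f i - e i) = (\<lambda>i. \<beta> *\<^sub>R v i - r i - \<gamma> *\<^sub>R q i)"
      by (simp add: fun_eq_iff f_def)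
    ultimately show ?thesis
      unfolding heavy_ball_energy_def V'_def N'_def sa by simp
  qed
  \<comment> \<open>Still an identity. The bracket with R^2 is the whole change when there is no
    gradient, and it is negative by \<open>residual_le\<close>; all gradient terms sit in the other
    two lines.\<close>
  have V_eq: "V' = V + (1 - \<beta>) * (R\<^sup>2 - 2 * (1 + \<beta>) * stack_inner n e r)
      - 2 * \<gamma> * ((1 - \<beta>\<^sup>2) * stack_inner n q e + (1 + \<beta>) * \<beta> * stack_inner n q v - stack_inner n q r)
      + (1 + \<beta>) * \<gamma>\<^sup>2 * (stack_norm n q)\<^sup>2"
    unfolding V_def V'_def f_def R_def stack_inner_self[symmetric] stack_inner_simps
    by (simp add: stack_inner_commute[of n r e] stack_inner_commute[of n v e]
        stack_inner_commute[of n e q] stack_inner_commute[of n r v] stack_inner_commute[of n v q]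
        stack_inner_commute[of n r q] algebra_simps power2_eq_square)
  have q: "stack_norm n q \<le> L * E"
    unfolding q_def E_def using stack_norm_mix_le[of h] h(1) by linarith
  \<comment> \<open>\<open>q\<close> is W h, but monotonicity concerns \<open>h\<close>: moving W
    onto \<open>e\<close> produces the residual \<open>r\<close>, at the price of L E R.\<close>
  have "stack_inner n q e = stack_inner n h e - stack_inner n h r"
    unfolding q_def r_def mix_self_adjoint stack_inner_simps by simp
  moreover have "stack_inner n h r \<le> L * E * R"
    using stack_inner_Cauchy_Schwarz[of n h r] mult_right_mono[OF h(1), of R] nonneg
    unfolding E_def R_def by linarith
  ultimately have qe: "\<mu> * E\<^sup>2 - L * E * R \<le> stack_inner n q e"
    using h(2) unfolding E_def by linarith
  have qr: "stack_inner n q r \<le> L * E * R"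
    using stack_inner_Cauchy_Schwarz[of n q r] mult_right_mono[OF q, of R] nonneg
    unfolding R_def by linarith
  have qv: "- (L * E * N) \<le> stack_inner n q v"
    using stack_inner_Cauchy_Schwarz[of n q v] mult_right_mono[OF q, of N] nonneg
    unfolding N_def by linarith
  have b1: "0 \<le> 1 - \<beta>\<^sup>2" "1 - \<beta>\<^sup>2 \<le> 1"
    using \<beta> by (auto simp: abs_square_le_1)
  have b2: "0 \<le> (1 + \<beta>) * \<beta>" "(1 + \<beta>) * \<beta> \<le> 2"
    using \<beta> mult_mono[of "1 + \<beta>" 2 \<beta> 1] by auto
  have LE: "0 \<le> L * E"
    using nonneg \<open>0 \<le> L\<close> by simp
  have "V' \<le> V - \<beta> * (1 - \<beta>) * R\<^sup>2 - 2 * \<gamma> * (1 - \<beta>\<^sup>2) * \<mu> * E\<^sup>2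
      + 4 * \<gamma> * L * E * R + 4 * \<gamma> * L * E * N + 2 * (\<gamma> * L * E)\<^sup>2"
  proof -
    have "R\<^sup>2 \<le> 2 * stack_inner n e r"
      unfolding R_def r_def by (rule residual_le)
    then have "(1 - \<beta>) * (1 + \<beta>) * R\<^sup>2 \<le> (1 - \<beta>) * (1 + \<beta>) * (2 * stack_inner n e r)"
      using \<beta> by (intro mult_left_mono) auto
    then have 1: "(1 - \<beta>) * (R\<^sup>2 - 2 * (1 + \<beta>) * stack_inner n e r) \<le> - (\<beta> * (1 - \<beta>) * R\<^sup>2)"
      by (simp add: algebra_simps)
    have "(1 - \<beta>\<^sup>2) * (\<mu> * E\<^sup>2 - L * E * R) \<le> (1 - \<beta>\<^sup>2) * stack_inner n q e"
      using qe b1 by (intro mult_left_mono)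
    moreover have "(1 - \<beta>\<^sup>2) * (L * E * R) \<le> 1 * (L * E * R)"
      using b1 LE nonneg by (intro mult_right_mono) auto
    moreover have "(1 + \<beta>) * \<beta> * - (L * E * N) \<le> (1 + \<beta>) * \<beta> * stack_inner n q v"
      using qv b2 by (intro mult_left_mono)
    moreover have "(1 + \<beta>) * \<beta> * (L * E * N) \<le> 2 * (L * E * N)"
      using b2 LE nonneg by (intro mult_right_mono) auto
    ultimately have "(1 - \<beta>\<^sup>2) * (\<mu> * E\<^sup>2) - 2 * (L * E * R) - 2 * (L * E * N)
      \<le> (1 - \<beta>\<^sup>2) * stack_inner n q e + (1 + \<beta>) * \<beta> * stack_inner n q v - stack_inner n q r"
      using qr by (simp add: right_diff_distrib)
    then have 2: "2 * \<gamma> * ((1 - \<beta>\<^sup>2) * (\<mu> * E\<^sup>2) - 2 * (L * E * R) - 2 * (L * E * N))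
      \<le> 2 * \<gamma> * ((1 - \<beta>\<^sup>2) * stack_inner n q e + (1 + \<beta>) * \<beta> * stack_inner n q v - stack_inner n q r)"
      using \<open>0 < \<gamma>\<close> by (intro mult_left_mono) auto
    have "(1 + \<beta>) * \<gamma>\<^sup>2 * (stack_norm n q)\<^sup>2 \<le> 2 * \<gamma>\<^sup>2 * (L * E)\<^sup>2"
      using \<beta> q LE \<open>0 < \<gamma>\<close> by (intro mult_mono power_mono mult_nonneg_nonneg) auto
    then have 3: "(1 + \<beta>) * \<gamma>\<^sup>2 * (stack_norm n q)\<^sup>2 \<le> 2 * (\<gamma> * L * E)\<^sup>2"
      by (simp add: power_mult_distrib mult.assoc)
    have 4: "2 * \<gamma> * ((1 - \<beta>\<^sup>2) * (\<mu> * E\<^sup>2) - 2 * (L * E * R) - 2 * (L * E * N))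
      = 2 * \<gamma> * (1 - \<beta>\<^sup>2) * \<mu> * E\<^sup>2 - 4 * \<gamma> * L * E * R - 4 * \<gamma> * L * E * N"
      by (simp add: algebra_simps)
    show ?thesis
      unfolding V_eq using 1 2 3 4 by linarith
  qed
  moreover have "N' \<le> \<beta> * N + (R + \<gamma> * L * E)"
  proof -
    have "N' \<le> stack_norm n (\<lambda>i. \<beta> *\<^sub>R v i - r i) + stack_norm n (\<lambda>i. \<gamma> *\<^sub>R q i)"
      unfolding N'_def by (rule stack_norm_triangle_diff)
    also have "stack_norm n (\<lambda>i. \<beta> *\<^sub>R v i - r i) \<le> stack_norm n (\<lambda>i. \<beta> *\<^sub>R v i) + R"
      unfolding R_def by (rule stack_norm_triangle_diff)
    also have "stack_norm n (\<lambda>i. \<beta> *\<^sub>R v i) = \<beta> * N"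
      using \<beta> by (simp only: stack_norm_scaleR N_def abs_of_pos)
    also have "stack_norm n (\<lambda>i. \<gamma> *\<^sub>R q i) \<le> \<gamma> * (L * E)"
      using \<open>0 < \<gamma>\<close> q by (simp only: stack_norm_scaleR abs_of_pos) (intro mult_left_mono, auto)
    finally show ?thesis
      by (simp add: mult.assoc)
  qed
  moreover have "0 \<le> N'"
    by (simp add: N'_def)
  ultimately show ?thesis
    unfolding energy_f en en' E_def[symmetric] v_def[symmetric] N_def[symmetric]
    using energy_balance[OF \<beta> \<open>0 < \<gamma>\<close> \<open>0 \<le> L\<close> nonneg _ _ _ \<gamma>] by blast
qed

text \<open>The first two terms are (1 + \<beta>) (|e|^2 + \<beta>^2 |m|^2) - 2 \<beta> <B e, m>
  with B = W + \<beta> I. As |B e| \<le> (1 + \<beta>) |e|, they dominate (1 + \<beta>) (|e| -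
  \<beta> |m|)^2.\<close>

lemma heavy_ball_energy_nonneg:
  assumes "0 < \<beta>" "\<beta> < 1"
  shows "0 \<le> heavy_ball_energy n w \<beta> e m"
proof -
  have "stack_inner n (\<lambda>i. mix n w e i + \<beta> *\<^sub>R e i) m
      \<le> stack_norm n (\<lambda>i. mix n w e i + \<beta> *\<^sub>R e i) * stack_norm n m"
    using stack_inner_Cauchy_Schwarz[of n "\<lambda>i. mix n w e i + \<beta> *\<^sub>R e i" m] by linarith
  also have "\<dots> \<le> (stack_norm n (mix n w e) + stack_norm n (\<lambda>i. \<beta> *\<^sub>R e i)) * stack_norm n m"
    by (intro mult_right_mono stack_norm_triangle) simp
  also have "\<dots> \<le> (stack_norm n e + \<beta> * stack_norm n e) * stack_norm n m"
    using assms by (intro mult_right_mono add_mono stack_norm_mix_le) (auto simp: stack_norm_scaleR)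
  finally have "2 * \<beta> * stack_inner n (\<lambda>i. mix n w e i + \<beta> *\<^sub>R e i) m
      \<le> 2 * \<beta> * ((stack_norm n e + \<beta> * stack_norm n e) * stack_norm n m)"
    using assms by (intro mult_left_mono) auto
  also have "\<dots> \<le> (1 + \<beta>) * ((stack_norm n e)\<^sup>2 + \<beta>\<^sup>2 * (stack_norm n m)\<^sup>2)"
  proof -
    have "(1 + \<beta>) * ((stack_norm n e)\<^sup>2 + \<beta>\<^sup>2 * (stack_norm n m)\<^sup>2)
        - 2 * \<beta> * ((stack_norm n e + \<beta> * stack_norm n e) * stack_norm n m)
        = (1 + \<beta>) * (stack_norm n e - \<beta> * stack_norm n m)\<^sup>2"
      by (simp add: algebra_simps power2_eq_square)
    also have "\<dots> \<ge> 0"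
      using assms by simp
    finally show ?thesis by simp
  qed
  also have "\<dots> = (1 + \<beta>) * (stack_norm n (\<lambda>i. e i - \<beta> *\<^sub>R m i))\<^sup>2
      + 2 * \<beta> * stack_inner n (\<lambda>i. e i - mix n w e i) m
      + 2 * \<beta> * stack_inner n (\<lambda>i. mix n w e i + \<beta> *\<^sub>R e i) m"
    unfolding stack_inner_self[symmetric] stack_inner_simps
    by (simp add: stack_inner_commute[of n m e] algebra_simps power2_eq_square)
  finally show ?thesis
    using assms by (simp add: heavy_ball_energy_def)
qed

text \<open>A step loses a multiple of |e|^2 + |e - m|^2; bounding the energy by this same quantity
  turns the loss into a contraction.\<close>

lemma heavy_ball_energy_le:
  assumes "0 < \<beta>" "\<beta> < 1"
  shows "heavy_ball_energy n w \<beta> e m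
    \<le> 18 * ((stack_norm n e)\<^sup>2 + (stack_norm n (\<lambda>i. e i - m i))\<^sup>2)"
proof -
  define v where "v = (\<lambda>i. e i - m i)"
  define E where "E = stack_norm n e"
  define N where "N = stack_norm n v"
  have nonneg: "0 \<le> E" "0 \<le> N"
    by (simp_all add: E_def N_def)
  have m: "stack_norm n m \<le> E + N"
    using stack_norm_triangle_diff[of n e v] by (simp add: v_def E_def N_def)
  have "stack_norm n (\<lambda>i. e i - \<beta> *\<^sub>R m i) \<le> E + \<bar>\<beta>\<bar> * stack_norm n m"
    unfolding E_def stack_norm_scaleR[symmetric] by (rule stack_norm_triangle_diff)
  also have "\<bar>\<beta>\<bar> * stack_norm n m \<le> 1 * (E + N)"
    using assms m by (intro mult_mono) auto
  finally have "(stack_norm n (\<lambda>i. e i - \<beta> *\<^sub>R m i))\<^sup>2 \<le> (2 * E + N)\<^sup>2"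
    by (intro power_mono) auto
  then have 1: "(1 + \<beta>) * (stack_norm n (\<lambda>i. e i - \<beta> *\<^sub>R m i))\<^sup>2 \<le> 2 * (2 * E + N)\<^sup>2"
    using assms by (intro mult_mono) auto
  have "stack_inner n (\<lambda>i. e i - mix n w e i) m \<le> stack_norm n (\<lambda>i. e i - mix n w e i) * stack_norm n m"
    using stack_inner_Cauchy_Schwarz[of n "\<lambda>i. e i - mix n w e i" m] by linarith
  also have "\<dots> \<le> (2 * E) * (E + N)"
    using stack_norm_triangle_diff[of n e "mix n w e"] stack_norm_mix_le[of e] m nonneg
    by (intro mult_mono) (auto simp: E_def)
  finally have "2 * \<beta> * stack_inner n (\<lambda>i. e i - mix n w e i) m \<le> 2 * \<beta> * ((2 * E) * (E + N))"
    using assms by (intro mult_left_mono) auto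
  also have "\<dots> \<le> 2 * 1 * ((2 * E) * (E + N))"
    using assms nonneg by (intro mult_right_mono) auto
  finally have 2: "2 * \<beta> * stack_inner n (\<lambda>i. e i - mix n w e i) m \<le> 4 * E\<^sup>2 + 4 * E * N"
    by (simp add: algebra_simps power2_eq_square)
  have "\<beta> * (1 - \<beta>)\<^sup>2 \<le> 1 * 1"
    using assms by (intro mult_mono) (auto simp: power_le_one_iff)
  then have 3: "\<beta> * (1 - \<beta>)\<^sup>2 / 4 * N\<^sup>2 \<le> 1 * N\<^sup>2"
    by (intro mult_right_mono) auto
  \<comment> \<open>Origin of 18: replacing 2 E N by E^2 + N^2 leaves 18 E^2 + 9 N^2.\<close>
  have "2 * (2 * E + N)\<^sup>2 + (4 * E\<^sup>2 + 4 * E * N) + N\<^sup>2 = 12 * E\<^sup>2 + 6 * (2 * E * N) + 3 * N\<^sup>2"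
    by (simp add: power2_eq_square algebra_simps)
  also have "\<dots> \<le> 18 * (E\<^sup>2 + N\<^sup>2)"
    using sum_squares_bound[of E N] zero_le_power2[of N] by (simp only: distrib_left)
  finally have "2 * (2 * E + N)\<^sup>2 + (4 * E\<^sup>2 + 4 * E * N) + N\<^sup>2 \<le> 18 * (E\<^sup>2 + N\<^sup>2)" .
  then show ?thesis
    unfolding heavy_ball_energy_def E_def[symmetric] v_def[symmetric] N_def[symmetric]
    using 1 2 3 by linarith
qed

lemma heavy_ball_summable:
  assumes \<beta>: "0 < \<beta>" "\<beta> < 1" and "0 < \<gamma>" "0 \<le> L" "0 < \<mu>"
    and h: "\<And>k. stack_norm n (h k) \<le> L * stack_norm n (e (Suc k))"
      "\<And>k. \<mu> * (stack_norm n (e (Suc k)))\<^sup>2 \<le> stack_inner n (h k) (e (Suc k))"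
    and \<gamma>: "\<gamma> * L\<^sup>2 * step_bound \<beta> \<le> (1 - \<beta>\<^sup>2) * \<mu>"
    and e: "\<And>k i. i < n \<Longrightarrow> e (Suc (Suc k)) i =
      mix n w (\<lambda>j. e (Suc k) j - \<gamma> *\<^sub>R h k j) i + \<beta> *\<^sub>R (e (Suc k) i - e k i)"
  shows "summable (\<lambda>k. stack_norm n (e k))"
proof -
  define \<Phi> where "\<Phi> k = heavy_ball_energy n w \<beta> (e (Suc k)) (e k)" for k
  define E where "E k = (stack_norm n (e (Suc k)))\<^sup>2" for k
  define N where "N k = (stack_norm n (\<lambda>i. e (Suc k) i - e k i))\<^sup>2" for k
  define \<tau> where "\<tau> = min 1 (min (energy_rate \<beta>) (\<gamma> * (1 - \<beta>\<^sup>2) * \<mu>))"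
  \<comment> \<open>The loss \<tau> (E + N) together with \<Phi> \<le> 18 (E + N) gives this
    contraction factor; capping \<tau> at 1 keeps it positive.\<close>
  define q where "q = 1 - \<tau> / 18"
  have "0 < 1 - \<beta>\<^sup>2"
    using \<beta> by (simp add: abs_square_less_1)
  then have \<tau>: "0 < \<tau>" "\<tau> \<le> 1" "\<tau> \<le> energy_rate \<beta>" "\<tau> \<le> \<gamma> * (1 - \<beta>\<^sup>2) * \<mu>"
    using \<beta> \<open>0 < \<gamma>\<close> \<open>0 < \<mu>\<close> by (auto simp: \<tau>_def energy_rate_def)
  then have q: "0 < q" "q < 1"
    by (auto simp: q_def)
  have nonneg: "0 \<le> E k" "0 \<le> N k" "0 \<le> \<Phi> k" for k
    using heavy_ball_energy_nonneg[OF \<beta>] by (auto simp: E_def N_def \<Phi>_def)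
  have step: "\<Phi> (Suc k) \<le> \<Phi> k - \<tau> * (E k + N k)" for k
  proof -
    have "\<Phi> (Suc k) \<le> \<Phi> k - energy_rate \<beta> * N k - \<gamma> * (1 - \<beta>\<^sup>2) * \<mu> * E k"
      unfolding \<Phi>_def E_def N_def
      by (rule heavy_ball_energy_step[OF \<beta> \<open>0 < \<gamma>\<close> \<open>0 \<le> L\<close> h \<gamma> e])
    moreover have "\<tau> * N k \<le> energy_rate \<beta> * N k" "\<tau> * E k \<le> \<gamma> * (1 - \<beta>\<^sup>2) * \<mu> * E k"
      using \<tau> nonneg by (auto intro!: mult_right_mono)
    ultimately show ?thesis
      by (simp add: distrib_left)
  qed
  have contract: "\<Phi> (Suc k) \<le> q * \<Phi> k" for k
  proof -
    have "\<tau> / 18 * \<Phi> k \<le> \<tau> / 18 * (18 * (E k + N k))"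
      using heavy_ball_energy_le[OF \<beta>] \<tau>(1) unfolding \<Phi>_def E_def N_def
      by (intro mult_left_mono) auto
    with step[of k] show ?thesis
      by (simp add: q_def algebra_simps)
  qed
  have \<Phi>_le: "\<Phi> k \<le> \<Phi> 0 * q ^ k" for k
  proof (induction k)
    case (Suc k)
    have "\<Phi> (Suc k) \<le> q * \<Phi> k"
      by (rule contract)
    also have "\<dots> \<le> q * (\<Phi> 0 * q ^ k)"
      using Suc q by (intro mult_left_mono) auto
    finally show ?case
      by (simp add: mult_ac)
  qed simp
  have bound: "stack_norm n (e (Suc k)) \<le> sqrt (\<Phi> 0 / \<tau>) * sqrt q ^ k" for k
  proof -
    \<comment> \<open>The increment is bounded through the loss: \<tau> (E + N) \<le> \<Phi> k -
      \<Phi> (k + 1), and \<Phi> (k + 1) is nonnegative.\<close>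
    have "\<tau> * E k \<le> \<Phi> k"
      using step[of k, unfolded distrib_left] nonneg(3)[of "Suc k"]
        mult_nonneg_nonneg[OF less_imp_le[OF \<tau>(1)] nonneg(2)[of k]] by linarith
    with \<Phi>_le[of k] have "E k \<le> \<Phi> 0 / \<tau> * q ^ k"
      using \<tau>(1) by (simp add: field_simps)
    then have "sqrt (E k) \<le> sqrt (\<Phi> 0 / \<tau> * q ^ k)"
      by (rule real_sqrt_le_mono)
    moreover have "sqrt (E k) = stack_norm n (e (Suc k))"
      by (simp add: E_def)
    ultimately show ?thesis
      by (simp only: real_sqrt_mult real_sqrt_power)
  qed
  have "summable (\<lambda>k. sqrt (\<Phi> 0 / \<tau>) * sqrt q ^ k)"
    using q by (intro summable_mult summable_geometric) auto
  then have "summable (\<lambda>k. stack_norm n (e (Suc k)))"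
    by (rule summable_comparison_test'[where N = 0]) (simp add: bound)
  then show ?thesis
    using summable_Suc_iff[of "\<lambda>k. stack_norm n (e k)"] by blast
qed

end

subsection \<open>Convergence and bias\<close>

lemma GDERIV_unique: "GDERIV f x :> D \<Longrightarrow> GDERIV f x :> D' \<Longrightarrow> D = D'"
  unfolding gderiv_def by (metis has_derivative_unique inner_commute vector_eq_rdot)

lemma smooth_fun_GDERIV:
  assumes "smooth_fun L f"
  shows "GDERIV f x :> grad f x"
proof -
  obtain D where D: "GDERIV f x :> D"
    using assms unfolding smooth_fun_def by blast
  show ?thesis
    unfolding grad_def by (rule theI[of "\<lambda>D. GDERIV f x :> D", OF D]) (rule GDERIV_unique[OF _ D])
qed

text \<open>Strong convexity on the segment from \<open>x\<close> to \<open>y\<close>, divided by t,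
  in the limit as t decreases to 0.\<close>

lemma strongly_convex_fun_ge_tangent:
  assumes conv: "strongly_convex_fun \<mu> f" and D: "GDERIV f x :> D"
  shows "f x + inner (y - x) D + \<mu> / 2 * (norm (x - y))\<^sup>2 \<le> f y"
proof -
  have "((\<lambda>t. f (x + t *\<^sub>R (y - x))) has_derivative (\<lambda>t. inner (t *\<^sub>R (y - x)) D)) (at 0)"
    by (rule has_derivative_compose[of "\<lambda>t. x + t *\<^sub>R (y - x)" _ 0 UNIV f])
      (use D in \<open>auto simp: gderiv_def intro!: derivative_eq_intros\<close>)
  then have "((\<lambda>t. f (x + t *\<^sub>R (y - x))) has_real_derivative inner (y - x) D) (at 0)"
    by (simp add: has_field_derivative_def mult_commute_abs)
  then have "((\<lambda>t. (f (x + t *\<^sub>R (y - x)) - f x) / t) \<longlongrightarrow> inner (y - x) D) (at 0)"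
    by (simp add: has_field_derivative_iff)
  then have lim: "((\<lambda>t. (f (x + t *\<^sub>R (y - x)) - f x) / t) \<longlongrightarrow> inner (y - x) D) (at_right 0)"
    by (rule filterlim_mono) (auto simp: at_le)
  have "((\<lambda>t. f y - f x - \<mu> / 2 * (1 - t) * (norm (x - y))\<^sup>2)
      \<longlongrightarrow> f y - f x - \<mu> / 2 * (1 - 0) * (norm (x - y))\<^sup>2) (at_right 0)"
    by (intro tendsto_intros)
  moreover have "eventually (\<lambda>t. (f (x + t *\<^sub>R (y - x)) - f x) / t
      \<le> f y - f x - \<mu> / 2 * (1 - t) * (norm (x - y))\<^sup>2) (at_right 0)"
  proof (rule eventually_at_rightI[of 0 1])
    fix t :: real assume "t \<in> {0<..<1}"
    then have t: "0 < t" "t < 1"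
      by auto
    have "x + t *\<^sub>R (y - x) = (1 - t) *\<^sub>R x + t *\<^sub>R y"
      by (simp add: algebra_simps)
    then have "f (x + t *\<^sub>R (y - x)) \<le> (1 - t) * f x + t * f y - \<mu> / 2 * t * (1 - t) * (norm (x - y))\<^sup>2"
      using conv t by (simp add: strongly_convex_fun_def)
    also have "\<dots> = f x + t * (f y - f x - \<mu> / 2 * (1 - t) * (norm (x - y))\<^sup>2)"
      by (simp add: algebra_simps)
    finally show "(f (x + t *\<^sub>R (y - x)) - f x) / t \<le> f y - f x - \<mu> / 2 * (1 - t) * (norm (x - y))\<^sup>2"
      using t by (simp add: pos_divide_le_eq mult.commute)
  qed auto
  ultimately have "inner (y - x) D \<le> f y - f x - \<mu> / 2 * (1 - 0) * (norm (x - y))\<^sup>2"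
    by (rule tendsto_le[OF trivial_limit_at_right_real _ lim])
  then show ?thesis by simp
qed

text \<open>Sum of the tangent inequalities at \<open>x\<close> and at \<open>y\<close>: the
  function values cancel and the two halves of \<mu> add up.\<close>

lemma strongly_convex_fun_grad_monotone:
  assumes "strongly_convex_fun \<mu> f" "smooth_fun L f"
  shows "\<mu> * (norm (x - y))\<^sup>2 \<le> inner (grad f x - grad f y) (x - y)"
  using strongly_convex_fun_ge_tangent[OF assms(1) smooth_fun_GDERIV[OF assms(2)], of x y]
    strongly_convex_fun_ge_tangent[OF assms(1) smooth_fun_GDERIV[OF assms(2)], of y x]
  by (simp add: inner_diff_left inner_diff_right inner_commute norm_minus_commute[of y x])

text \<open>Fermat's rule for the average. The single gradients may be nonzero at the minimizer;
  their size is the data inconsistency.\<close>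

lemma sum_grad_minimizer:
  fixes f :: "nat \<Rightarrow> 'a::euclidean_space \<Rightarrow> real"
  assumes "\<And>i. i < n \<Longrightarrow> smooth_fun L (f i)" "\<And>y. avg_fun n f x \<le> avg_fun n f y" "n > 0"
  shows "(\<Sum>i<n. grad (f i) x) = 0"
proof -
  have "((\<lambda>x. \<Sum>i<n. f i x) has_derivative (\<lambda>h. \<Sum>i<n. inner h (grad (f i) x))) (at x)"
    using smooth_fun_GDERIV[OF assms(1)] unfolding gderiv_def by (intro has_derivative_sum) auto
  moreover have "(\<Sum>i<n. f i x) \<le> (\<Sum>i<n. f i y)" for y
    using assms(2)[of y] \<open>n > 0\<close> by (simp add: avg_fun_def divide_le_cancel)
  ultimately have "(\<lambda>h. \<Sum>i<n. inner h (grad (f i) x)) = (\<lambda>h. 0)"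
    by (intro differential_zero_maxmin[of x UNIV "\<lambda>x. \<Sum>i<n. f i x"]) auto
  then have "inner (\<Sum>i<n. grad (f i) x) (\<Sum>i<n. grad (f i) x) = 0"
    unfolding inner_sum_right by metis
  then show ?thesis by simp
qed

lemma neighbours_sum:
  assumes "weight_matrix n G W" "i < n"
  shows "(\<Sum>j\<in>neighbours n W i. W $$ (i, j) *\<^sub>R x j) = mix n (\<lambda>i j. W $$ (i, j)) x i"
  unfolding mix_def
proof (rule sum.mono_neutral_left)
  show "\<forall>j\<in>{..<n} - neighbours n W i. W $$ (i, j) *\<^sub>R x j = 0"
  proof
    fix j assume "j \<in> {..<n} - neighbours n W i"
    then have "j < n" "\<not> W $$ (i, j) > 0"
      by (auto simp: neighbours_def)
    moreover have "if (j, i) \<in> parcs G \<or> i = j then W $$ (i, j) > 0 else W $$ (i, j) = 0"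
      using assms \<open>j < n\<close> unfolding weight_matrix_def by blast
    ultimately show "W $$ (i, j) *\<^sub>R x j = 0"
      by (simp split: if_splits)
  qed
qed (auto simp: neighbours_def)

text \<open>The momentum can be read off the iterates: \<gamma> m(k+1) = x(k) - x(k+1).
  Multiplication by \<gamma> also removes the factor 1 / \<gamma> from
  \<open>decentlam_g\<close>.\<close>

lemma decentlam_x_heavy_ball:
  fixes f :: "nat \<Rightarrow> 'a::real_inner \<Rightarrow> real" and x0 :: "nat \<Rightarrow> 'a" and n W \<gamma> \<beta>
  defines "X \<equiv> decentlam_x n W f \<gamma> \<beta> x0"
  assumes W: "weight_matrix n G W" and "i < n" "\<gamma> \<noteq> 0"
  shows "X (Suc (Suc k)) i = mix n (\<lambda>i j. W $$ (i, j)) (\<lambda>j. X (Suc k) j - \<gamma> *\<^sub>R grad (f j) (X (Suc k) j)) i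
    + \<beta> *\<^sub>R (X (Suc k) i - X k i)"
proof -
  define m where "m k = snd (decentlam n W f \<gamma> \<beta> x0 k)" for k
  have m_Suc: "m (Suc k) i = \<beta> *\<^sub>R m k i + decentlam_g n W f \<gamma> (X k) i" for k
    by (simp add: m_def X_def decentlam_x_def[abs_def] Let_def split: prod.splits)
  have X_Suc: "X (Suc k) i = X k i - \<gamma> *\<^sub>R m (Suc k) i" for k
    by (simp add: m_def X_def decentlam_x_def[abs_def] Let_def split: prod.splits)
  have "\<gamma> *\<^sub>R decentlam_g n W f \<gamma> x i = x i - mix n (\<lambda>i j. W $$ (i, j)) (\<lambda>j. x j - \<gamma> *\<^sub>R grad (f j) (x j)) i" for x
    unfolding decentlam_g_def neighbours_sum[OF W \<open>i < n\<close>]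
    using \<open>\<gamma> \<noteq> 0\<close> by (simp add: scaleR_diff_right)
  moreover have "\<beta> *\<^sub>R (\<gamma> *\<^sub>R m (Suc k) i) = \<beta> *\<^sub>R (X k i - X (Suc k) i)"
    by (simp add: X_Suc)
  ultimately show ?thesis
    unfolding X_Suc[of "Suc k"] m_Suc[of "Suc k"] scaleR_add_right
    by (simp add: scaleR_left_commute[of \<gamma> \<beta>] algebra_simps)
qed

section \<open>Existence of the limit and its distance to the minimizer\<close>

context mixing_matrix
begin

text \<open>Increments obey the same recursion with gradient differences in place of gradients, so
  they are summable; telescoping gives the limits, and continuity of \<open>G\<close> passes the
  recursion to them.\<close>

lemma heavy_ball_converges:
  fixes G :: "nat \<Rightarrow> 'a::euclidean_space \<Rightarrow> 'a"
  assumes \<beta>: "0 < \<beta>" "\<beta> < 1" and "0 < \<gamma>" "0 \<le> L" "0 < \<mu>"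
    and lipschitz: "\<And>i x y. i < n \<Longrightarrow> norm (G i x - G i y) \<le> L * norm (x - y)"
    and monotone: "\<And>i x y. i < n \<Longrightarrow> \<mu> * (norm (x - y))\<^sup>2 \<le> inner (G i x - G i y) (x - y)"
    and \<gamma>: "\<gamma> * L\<^sup>2 * step_bound \<beta> \<le> (1 - \<beta>\<^sup>2) * \<mu>"
    and X: "\<And>k i. i < n \<Longrightarrow> X (Suc (Suc k)) i =
      mix n w (\<lambda>j. X (Suc k) j - \<gamma> *\<^sub>R G j (X (Suc k) j)) i + \<beta> *\<^sub>R (X (Suc k) i - X k i)"
  obtains y where "\<And>i. i < n \<Longrightarrow> (\<lambda>k. X k i) \<longlonglongrightarrow> y i"
    "\<And>i. i < n \<Longrightarrow> y i = mix n w (\<lambda>j. y j - \<gamma> *\<^sub>R G j (y j)) i"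
proof -
  define e where "e k i = X (Suc k) i - X k i" for k i
  \<comment> \<open>The index is shifted: \<open>h k\<close> is the gradient difference across the
    increment \<open>e (Suc k)\<close>.\<close>
  define h where "h k i = G i (X (Suc (Suc k)) i) - G i (X (Suc k) i)" for k i
  have "summable (\<lambda>k. stack_norm n (e k))"
  proof (rule heavy_ball_summable[OF \<beta> \<open>0 < \<gamma>\<close> \<open>0 \<le> L\<close> \<open>0 < \<mu>\<close> _ _ \<gamma>])
    show "stack_norm n (h k) \<le> L * stack_norm n (e (Suc k))" for k
      using \<open>0 \<le> L\<close> by (intro stack_norm_Lipschitz) (auto simp: h_def e_def lipschitz)
    show "\<mu> * (stack_norm n (e (Suc k)))\<^sup>2 \<le> stack_inner n (h k) (e (Suc k))" for k
      unfolding stack_norm_power2 stack_inner_def sum_distrib_left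
      by (intro sum_mono) (auto simp: h_def e_def monotone)
    show "e (Suc (Suc k)) i =
      mix n w (\<lambda>j. e (Suc k) j - \<gamma> *\<^sub>R h k j) i + \<beta> *\<^sub>R (e (Suc k) i - e k i)" if "i < n" for k i
    proof -
      have "(\<lambda>j. e (Suc k) j - \<gamma> *\<^sub>R h k j) =
        (\<lambda>j. (X (Suc (Suc k)) j - \<gamma> *\<^sub>R G j (X (Suc (Suc k)) j)) - (X (Suc k) j - \<gamma> *\<^sub>R G j (X (Suc k) j)))"
        by (simp add: fun_eq_iff e_def h_def algebra_simps)
      then show ?thesis
        using X[OF that, of "Suc k"] X[OF that, of k]
        by (simp add: mix_diff e_def scaleR_diff_right)
    qed
  qed
  then have summable_e: "summable (\<lambda>k. e k i)" if "i < n" for i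
    by (rule summable_comparison_test'[where N = 0]) (rule norm_le_stack_norm[OF that])
  have "\<exists>l. (\<lambda>k. X k i) \<longlonglongrightarrow> l" if "i < n" for i
  proof -
    have "(\<lambda>k. (\<Sum>j<k. e j i) + X 0 i) \<longlonglongrightarrow> suminf (\<lambda>k. e k i) + X 0 i"
      by (intro tendsto_add summable_LIMSEQ tendsto_const summable_e that)
    moreover have "(\<Sum>j<k. e j i) = X k i - X 0 i" for k
      unfolding e_def by (rule sum_lessThan_telescope)
    ultimately show ?thesis
      by auto
  qed
  then obtain y where y: "\<And>i. i < n \<Longrightarrow> (\<lambda>k. X k i) \<longlonglongrightarrow> y i"
    by metis
  have "y i = mix n w (\<lambda>j. y j - \<gamma> *\<^sub>R G j (y j)) i" if "i < n" for i
  proof -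
    have G_lim: "(\<lambda>k. G j (X (Suc k) j)) \<longlonglongrightarrow> G j (y j)" if "j < n" for j
    proof -
      have "(\<lambda>k. X (Suc k) j - y j) \<longlonglongrightarrow> 0"
        using LIMSEQ_Suc[OF y[OF that]] by (simp add: LIM_zero)
      then have "(\<lambda>k. L * norm (X (Suc k) j - y j)) \<longlonglongrightarrow> 0"
        by (intro tendsto_mult_right_zero tendsto_norm_zero)
      then have "(\<lambda>k. G j (X (Suc k) j) - G j (y j)) \<longlonglongrightarrow> 0"
        by (rule Lim_null_comparison[rotated]) (simp add: lipschitz that)
      then show ?thesis
        by (rule LIM_zero_cancel)
    qed
    \<comment> \<open>In the limit the momentum term is a difference of equal vectors, so \<beta>
      leaves the fixed point equation.\<close>
    have "(\<lambda>k. mix n w (\<lambda>j. X (Suc k) j - \<gamma> *\<^sub>R G j (X (Suc k) j)) i + \<beta> *\<^sub>R (X (Suc k) i - X k i))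
        \<longlonglongrightarrow> mix n w (\<lambda>j. y j - \<gamma> *\<^sub>R G j (y j)) i + \<beta> *\<^sub>R (y i - y i)"
      unfolding mix_def
      using LIMSEQ_Suc[OF y] y G_lim that by (intro tendsto_intros) auto
    moreover have "(\<lambda>k. X (Suc (Suc k)) i) \<longlonglongrightarrow> y i"
      by (intro LIMSEQ_Suc y that)
    ultimately show ?thesis
      using LIMSEQ_unique by (fastforce simp: X[OF that])
  qed
  with y show thesis
    by (rule that)
qed

text \<open>With u = y - x, the deviation and centre estimates give (1 - \<rho>) |u| \<le> K
  \<gamma> (|g0| + L |u|). The bound on \<gamma> lets the |u| on the right take at most half of the
  left side, whence the factor 2 and, squared, 4.\<close>

lemma fixed_point_bias:
  fixes G :: "nat \<Rightarrow> 'a::euclidean_space \<Rightarrow> 'a"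
  assumes "0 < n" "0 < \<gamma>" "0 \<le> L" "0 < \<mu>" "\<rho> < 1"
    and lipschitz: "\<And>i x y. i < n \<Longrightarrow> norm (G i x - G i y) \<le> L * norm (x - y)"
    and monotone: "\<And>i x y. i < n \<Longrightarrow> \<mu> * (norm (x - y))\<^sup>2 \<le> inner (G i x - G i y) (x - y)"
    and gap: "\<And>z :: nat \<Rightarrow> 'a. (\<Sum>i<n. z i) = 0 \<Longrightarrow> stack_inner n z (mix n w z) \<le> \<rho> * (stack_norm n z)\<^sup>2"
    and opt: "(\<Sum>i<n. G i x) = 0"
    and fixed: "\<And>i. i < n \<Longrightarrow> y i = mix n w (\<lambda>j. y j - \<gamma> *\<^sub>R G j (y j)) i"
    and \<gamma>: "2 * L * (1 + L / \<mu>) * \<gamma> \<le> 1 - \<rho>"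
  shows "(\<Sum>i<n. (norm (y i - x))\<^sup>2)
    \<le> 4 * (1 + L / \<mu>)\<^sup>2 * (\<gamma>\<^sup>2 * (\<Sum>i<n. (norm (G i x))\<^sup>2) / (1 - \<rho>)\<^sup>2)"
proof -
  define g where "g i = G i (y i)" for i
  define g0 where "g0 i = G i x" for i
  define c where "c = (1 / real n) *\<^sub>R (\<Sum>i<n. y i)"
  define z where "z i = y i - c" for i
  define s where "s = (\<lambda>i::nat. c - x)"
  define u where "u i = y i - x" for i
  define K where "K = 1 + L / \<mu>"
  have K: "0 < K"
    using assms by (simp add: K_def add_pos_nonneg)
  \<comment> \<open>Mixing preserves sums, so summing the fixed point equation leaves only the
    gradients.\<close>
  have "(\<Sum>i<n. y i) = (\<Sum>i<n. mix n w (\<lambda>j. y j - \<gamma> *\<^sub>R g j) i)"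
    using fixed by (simp add: g_def)
  also have "\<dots> = (\<Sum>i<n. y i) - \<gamma> *\<^sub>R (\<Sum>i<n. g i)"
    unfolding sum_mix by (simp add: sum_subtractf scaleR_sum_right)
  finally have sum_g: "(\<Sum>i<n. g i) = 0"
    using \<open>0 < \<gamma>\<close> by simp
  have "(\<Sum>i<n. z i) = 0"
    using \<open>0 < n\<close> by (simp add: z_def c_def sum_subtractf sum_constant_scaleR)
  then have "(1 - \<rho>) * (stack_norm n z)\<^sup>2 \<le> (stack_norm n z)\<^sup>2 - stack_inner n z (mix n w z)"
    using gap[of z] by (simp add: algebra_simps)
  also have "\<dots> = stack_inner n z (\<lambda>i. z i - mix n w z i)"
    by (simp add: stack_inner_simps stack_inner_self)
  also have "\<dots> = stack_inner n z (\<lambda>i. (- \<gamma>) *\<^sub>R mix n w g i)"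
  proof (rule stack_inner_cong)
    fix i assume i: "i < n"
    have "mix n w z i = mix n w y i - c"
      unfolding z_def using mix_const[OF i] by (simp add: mix_diff)
    moreover have "y i = mix n w y i - \<gamma> *\<^sub>R mix n w g i"
      using fixed[OF i] by (simp add: mix_diff mix_scaleR g_def[abs_def])
    ultimately show "z i - mix n w z i = (- \<gamma>) *\<^sub>R mix n w g i"
      unfolding z_def by (simp add: algebra_simps)
  qed simp
  also have "\<dots> \<le> \<gamma> * (stack_norm n z * stack_norm n (mix n w g))"
    unfolding stack_inner_scaleR_right
    using stack_inner_Cauchy_Schwarz[of n z "mix n w g"] \<open>0 < \<gamma>\<close>
      mult_left_mono[of "- stack_inner n z (mix n w g)" "stack_norm n z * stack_norm n (mix n w g)" \<gamma>]
    by auto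
  also have "\<dots> \<le> \<gamma> * (stack_norm n z * stack_norm n g)"
    using \<open>0 < \<gamma>\<close> by (intro mult_left_mono stack_norm_mix_le) auto
  finally have "stack_norm n z * ((1 - \<rho>) * stack_norm n z) \<le> stack_norm n z * (\<gamma> * stack_norm n g)"
    by (simp add: power2_eq_square mult_ac)
  then have z: "(1 - \<rho>) * stack_norm n z \<le> \<gamma> * stack_norm n g"
  proof (cases "stack_norm n z = 0")
    case True
    then show ?thesis
      using \<open>0 < \<gamma>\<close> by simp
  next
    case False
    then have "0 < stack_norm n z"
      using stack_norm_nonneg[of n z] by linarith
    then show ?thesis
      using \<open>stack_norm n z * ((1 - \<rho>) * stack_norm n z) \<le> stack_norm n z * (\<gamma> * stack_norm n g)\<close>
      by (rule mult_left_le_imp_le[rotated])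
  qed
  have g: "stack_norm n g \<le> stack_norm n g0 + L * stack_norm n u"
  proof -
    have "stack_norm n g \<le> stack_norm n g0 + stack_norm n (\<lambda>i. g i - g0 i)"
      using stack_norm_triangle[of n g0 "\<lambda>i. g i - g0 i"] by simp
    also have "stack_norm n (\<lambda>i. g i - g0 i) \<le> L * stack_norm n u"
      using \<open>0 \<le> L\<close> by (intro stack_norm_Lipschitz) (auto simp: g_def g0_def u_def lipschitz)
    finally show ?thesis by simp
  qed
  have s: "stack_norm n s \<le> L / \<mu> * stack_norm n z"
  proof (cases "stack_norm n s = 0")
    case True
    then show ?thesis
      using assms by simp
  next
    case False
    then have pos: "0 < stack_norm n s"
      using stack_norm_nonneg[of n s] by linarith
    have "\<mu> * (stack_norm n s)\<^sup>2 \<le> stack_inner n (\<lambda>i. G i c - g0 i) s"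
      unfolding stack_norm_power2 stack_inner_def sum_distrib_left
      by (intro sum_mono) (auto simp: s_def g0_def monotone)
    \<comment> \<open>\<open>s\<close> is constant and both \<open>g0\<close> and \<open>g\<close>
      have zero sum, so they can be exchanged. The new difference compares \<open>c\<close> with
      \<open>y i\<close> and is controlled by \<open>z\<close>.\<close>
    also have "\<dots> = stack_inner n (\<lambda>i. G i c - g i) s"
      using opt sum_g unfolding stack_inner_diff_left
      by (simp add: stack_inner_def s_def g0_def inner_sum_left[symmetric])
    also have "\<dots> \<le> stack_norm n (\<lambda>i. G i c - g i) * stack_norm n s"
      using stack_inner_Cauchy_Schwarz[of n "\<lambda>i. G i c - g i" s] by linarith
    also have "stack_norm n (\<lambda>i. G i c - g i) \<le> L * stack_norm n z"
      using \<open>0 \<le> L\<close> lipschitz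
      by (intro stack_norm_Lipschitz) (auto simp: g_def z_def norm_minus_commute[of _ c])
    finally have "\<mu> * stack_norm n s \<le> L * stack_norm n z"
      using pos by (simp add: power2_eq_square mult.assoc[symmetric])
    then show ?thesis
      using \<open>0 < \<mu>\<close> by (simp add: field_simps)
  qed
  have "stack_norm n u \<le> stack_norm n z + stack_norm n s"
    using stack_norm_triangle[of n z s] by (simp add: z_def s_def u_def[abs_def])
  then have "stack_norm n u \<le> K * stack_norm n z"
    using s by (simp add: K_def distrib_right)
  then have "(1 - \<rho>) * stack_norm n u \<le> (1 - \<rho>) * (K * stack_norm n z)"
    using \<open>\<rho> < 1\<close> by (intro mult_left_mono) auto
  also have "\<dots> \<le> K * (\<gamma> * stack_norm n g)"
    using mult_left_mono[OF z, of K] K by (simp add: mult_ac)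
  also have "\<dots> \<le> K * (\<gamma> * (stack_norm n g0 + L * stack_norm n u))"
    using K g \<open>0 < \<gamma>\<close> by (intro mult_left_mono) auto
  finally have 1: "2 * ((1 - \<rho>) * stack_norm n u) \<le> 2 * K * \<gamma> * stack_norm n g0 + 2 * L * K * \<gamma> * stack_norm n u"
    by (simp add: algebra_simps)
  \<comment> \<open>Absorption: doubling the inequality makes the feedback term at most one of the
    two copies on the left.\<close>
  have "2 * L * K * \<gamma> * stack_norm n u \<le> (1 - \<rho>) * stack_norm n u"
    using \<gamma> unfolding K_def[symmetric] by (intro mult_right_mono) auto
  with 1 have "(1 - \<rho>) * stack_norm n u \<le> 2 * K * \<gamma> * stack_norm n g0"
    by linarith
  then have "stack_norm n u \<le> 2 * K * \<gamma> * stack_norm n g0 / (1 - \<rho>)"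
    using \<open>\<rho> < 1\<close> by (simp add: pos_le_divide_eq mult.commute)
  then have "(stack_norm n u)\<^sup>2 \<le> (2 * K * \<gamma> * stack_norm n g0 / (1 - \<rho>))\<^sup>2"
    by (intro power_mono) auto
  also have "\<dots> = 4 * K\<^sup>2 * (\<gamma>\<^sup>2 * (stack_norm n g0)\<^sup>2 / (1 - \<rho>)\<^sup>2)"
    by (simp add: power_divide power_mult_distrib)
  finally show ?thesis
    unfolding stack_norm_power2 u_def g0_def K_def .
qed

end

text \<open>\<open>C\<close> is chosen before \<beta> and \<rho>, so the bias depends on the network
  only through the displayed power of 1 - \<rho>. The threshold for \<gamma> may depend on \<beta>
  and \<rho>, but is uniform in network, objectives and starting point.\<close>

theorem proposition3:
  fixes n :: nat and L \<mu> :: real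
  assumes "n \<ge> 2" and "\<mu> > 0"
  shows "\<exists>C. \<forall>\<beta> \<rho>. 0 < \<beta> \<and> \<beta> < 1 \<longrightarrow>
    (\<exists>\<gamma>\<^sub>0 > 0. \<forall>(G :: nat pair_pre_digraph) (W :: real mat)
        (f :: nat \<Rightarrow> 'a::euclidean_space \<Rightarrow> real) (xstar :: 'a) (x0 :: nat \<Rightarrow> 'a) \<gamma>.
      pair_graph G \<and> pverts G = {..<n} \<and> strongly_connected (with_proj G) \<and>
      weight_matrix n G W \<and>
      transpose_mat W = W \<and>
      W *\<^sub>v vec n (\<lambda>_. 1) = vec n (\<lambda>_. 1) \<and>
      \<rho> = mixing_rate n W \<and>
      (\<forall>i<n. smooth_fun L (f i)) \<and>
      (\<forall>i<n. strongly_convex_fun \<mu> (f i)) \<and>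
      (\<forall>y. avg_fun n f xstar \<le> avg_fun n f y) \<and>
      0 < \<gamma> \<and> \<gamma> \<le> \<gamma>\<^sub>0 \<longrightarrow>
        convergent (\<lambda>k. \<Sum>i<n. (norm (decentlam_x n W f \<gamma> \<beta> x0 k i - xstar))\<^sup>2) \<and>
        lim (\<lambda>k. \<Sum>i<n. (norm (decentlam_x n W f \<gamma> \<beta> x0 k i - xstar))\<^sup>2)
          \<le> C * (\<gamma>\<^sup>2 * data_inconsistency_sq n f xstar / (1 - \<rho>)\<^sup>2))"
proof -
  \<comment> \<open>\<open>L\<close> comes without a sign, while the thresholds divide by the
    Lipschitz constant; \<open>M\<close> is a strictly positive one.\<close>
  define M where "M = \<bar>L\<bar> + 1"
  have M: "0 < M" "L \<le> M"
    by (auto simp: M_def)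
  define K where "K = 1 + M / \<mu>"
  have K: "0 < K"
    using M assms(2) by (simp add: K_def add_pos_pos)
  show ?thesis
  proof (rule exI[of _ "4 * K\<^sup>2 * real n"], intro allI impI)
    fix \<beta> \<rho> :: real
    assume "0 < \<beta> \<and> \<beta> < 1"
    then have \<beta>: "0 < \<beta>" "\<beta> < 1"
      by auto
    then have rate: "0 < energy_rate \<beta>"
      by (simp add: energy_rate_def)
    then have S: "0 < step_bound \<beta>"
      using \<beta> by (simp add: step_bound_def add_pos_pos)
    have "0 < 1 - \<beta>\<^sup>2"
      using \<beta> by (simp add: abs_square_less_1)
    then have num: "0 < (1 - \<beta>\<^sup>2) * \<mu>"
      using assms(2) by simp
    \<comment> \<open>The first entry serves the energy decay, the second the absorption in
      \<open>fixed_point_bias\<close>. At this point \<rho> is still an arbitrary real; for \<rho>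
      \<ge> 1 the value 1 merely keeps the threshold positive, as no admissible \<open>W\<close> has
      such a rate.\<close>
    define \<gamma>0 where "\<gamma>0 = min ((1 - \<beta>\<^sup>2) * \<mu> / (M\<^sup>2 * step_bound \<beta>))
      (if \<rho> < 1 then (1 - \<rho>) / (2 * M * K) else 1)"
    have "0 < \<gamma>0"
      using num S M K by (simp add: \<gamma>0_def)
    moreover have "convergent (\<lambda>k. \<Sum>i<n. (norm (decentlam_x n W f \<gamma> \<beta> x0 k i - xstar))\<^sup>2) \<and>
        lim (\<lambda>k. \<Sum>i<n. (norm (decentlam_x n W f \<gamma> \<beta> x0 k i - xstar))\<^sup>2)
          \<le> 4 * K\<^sup>2 * real n * (\<gamma>\<^sup>2 * data_inconsistency_sq n f xstar / (1 - \<rho>)\<^sup>2)"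
      if asm: "pair_graph G \<and> pverts G = {..<n} \<and> strongly_connected (with_proj G) \<and>
        weight_matrix n G W \<and> transpose_mat W = W \<and>
        W *\<^sub>v vec n (\<lambda>_. 1) = vec n (\<lambda>_. 1) \<and> \<rho> = mixing_rate n W \<and>
        (\<forall>i<n. smooth_fun L (f i)) \<and> (\<forall>i<n. strongly_convex_fun \<mu> (f i)) \<and>
        (\<forall>y. avg_fun n f xstar \<le> avg_fun n f y) \<and> 0 < \<gamma> \<and> \<gamma> \<le> \<gamma>0"
      for G :: "nat pair_pre_digraph" and W :: "real mat" and f :: "nat \<Rightarrow> 'a \<Rightarrow> real"
        and xstar :: 'a and x0 :: "nat \<Rightarrow> 'a" and \<gamma> :: real
    proof -
      have G: "strongly_connected (with_proj G)" "pverts G = {..<n}"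
        and W: "weight_matrix n G W" "transpose_mat W = W" "W *\<^sub>v vec n (\<lambda>_. 1) = vec n (\<lambda>_. 1)"
        and \<rho>: "\<rho> = mixing_rate n W" and smooth: "\<And>i. i < n \<Longrightarrow> smooth_fun L (f i)"
        and convex: "\<And>i. i < n \<Longrightarrow> strongly_convex_fun \<mu> (f i)"
        and min: "\<And>y. avg_fun n f xstar \<le> avg_fun n f y" and \<gamma>: "0 < \<gamma>" "\<gamma> \<le> \<gamma>0"
        using asm by auto
      define w where "w = (\<lambda>i j. W $$ (i, j))"
      interpret mixing_matrix n w
        unfolding w_def by (rule weight_matrix_mixing_matrix[OF W])
      have "\<rho> < 1"
        unfolding \<rho> by (rule mixing_rate_spectral_gap(1)[OF assms(1) G W])
      have gap: "stack_inner n z (mix n w z) \<le> \<rho> * (stack_norm n z)\<^sup>2"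
        if "(\<Sum>i<n. z i) = 0" for z :: "nat \<Rightarrow> 'a"
        unfolding \<rho> w_def by (rule mixing_rate_spectral_gap(2)[OF assms(1) G W that])
      have lipschitz: "norm (grad (f i) x - grad (f i) y) \<le> M * norm (x - y)" if "i < n" for i x y
      proof -
        have "norm (grad (f i) x - grad (f i) y) \<le> L * norm (x - y)"
          using smooth[OF that] by (simp add: smooth_fun_def)
        also have "\<dots> \<le> M * norm (x - y)"
          using M by (intro mult_right_mono) auto
        finally show ?thesis .
      qed
      have monotone: "\<mu> * (norm (x - y))\<^sup>2 \<le> inner (grad (f i) x - grad (f i) y) (x - y)"
        if "i < n" for i x y
        using convex[OF that] smooth[OF that] by (rule strongly_convex_fun_grad_monotone)
      have "\<gamma> \<le> (1 - \<beta>\<^sup>2) * \<mu> / (M\<^sup>2 * step_bound \<beta>)"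
        using \<gamma>(2) by (simp add: \<gamma>0_def)
      then have \<gamma>1: "\<gamma> * M\<^sup>2 * step_bound \<beta> \<le> (1 - \<beta>\<^sup>2) * \<mu>"
        using M S by (simp add: pos_le_divide_eq mult.assoc)
      have "\<gamma> \<le> (1 - \<rho>) / (2 * M * K)"
        using \<gamma>(2) \<open>\<rho> < 1\<close> by (simp add: \<gamma>0_def)
      then have \<gamma>2: "2 * M * (1 + M / \<mu>) * \<gamma> \<le> 1 - \<rho>"
        using M K unfolding K_def[symmetric] by (simp add: pos_le_divide_eq mult_ac)
      have M0: "0 \<le> M"
        using M by simp
      define X where "X = decentlam_x n W f \<gamma> \<beta> x0"
      have X: "X (Suc (Suc k)) i = mix n w (\<lambda>j. X (Suc k) j - \<gamma> *\<^sub>R grad (f j) (X (Suc k) j)) i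
        + \<beta> *\<^sub>R (X (Suc k) i - X k i)" if "i < n" for k i
        unfolding X_def w_def using W(1) that \<gamma>(1) by (intro decentlam_x_heavy_ball) auto
      obtain y where y: "\<And>i. i < n \<Longrightarrow> (\<lambda>k. X k i) \<longlonglongrightarrow> y i"
        "\<And>i. i < n \<Longrightarrow> y i = mix n w (\<lambda>j. y j - \<gamma> *\<^sub>R grad (f j) (y j)) i"
        by (rule heavy_ball_converges[where G = "\<lambda>i. grad (f i)" and X = X,
            OF \<beta> \<gamma>(1) M0 assms(2) lipschitz monotone \<gamma>1 X]) auto
      have lim: "(\<lambda>k. \<Sum>i<n. (norm (X k i - xstar))\<^sup>2) \<longlonglongrightarrow> (\<Sum>i<n. (norm (y i - xstar))\<^sup>2)"
        using y(1) by (intro tendsto_intros) auto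
      have "0 < n"
        using assms(1) by simp
      have "(\<Sum>i<n. (norm (y i - xstar))\<^sup>2)
        \<le> 4 * (1 + M / \<mu>)\<^sup>2 * (\<gamma>\<^sup>2 * (\<Sum>i<n. (norm (grad (f i) xstar))\<^sup>2) / (1 - \<rho>)\<^sup>2)"
        using sum_grad_minimizer[OF smooth min \<open>0 < n\<close>]
        by (intro fixed_point_bias[where G = "\<lambda>i. grad (f i)" and y = y,
            OF \<open>0 < n\<close> \<gamma>(1) M0 assms(2) \<open>\<rho> < 1\<close> lipschitz monotone gap _ y(2) \<gamma>2])
      \<comment> \<open>The factor \<open>real n\<close> in the constant converts the sum of squares
        into the average in \<open>data_inconsistency_sq\<close>.\<close>
      also have "\<dots> = 4 * K\<^sup>2 * real n * (\<gamma>\<^sup>2 * data_inconsistency_sq n f xstar / (1 - \<rho>)\<^sup>2)"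
        using \<open>0 < n\<close> by (simp add: K_def data_inconsistency_sq_def)
      finally show ?thesis
        using lim limI[OF lim] unfolding X_def convergent_def by auto
    qed
    ultimately show "\<exists>\<gamma>\<^sub>0 > 0. \<forall>(G :: nat pair_pre_digraph) (W :: real mat)
        (f :: nat \<Rightarrow> 'a \<Rightarrow> real) (xstar :: 'a) (x0 :: nat \<Rightarrow> 'a) \<gamma>.
      pair_graph G \<and> pverts G = {..<n} \<and> strongly_connected (with_proj G) \<and>
      weight_matrix n G W \<and>
      transpose_mat W = W \<and>
      W *\<^sub>v vec n (\<lambda>_. 1) = vec n (\<lambda>_. 1) \<and>
      \<rho> = mixing_rate n W \<and>
      (\<forall>i<n. smooth_fun L (f i)) \<and>
      (\<forall>i<n. strongly_convex_fun \<mu> (f i)) \<and>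
      (\<forall>y. avg_fun n f xstar \<le> avg_fun n f y) \<and>
      0 < \<gamma> \<and> \<gamma> \<le> \<gamma>\<^sub>0 \<longrightarrow>
        convergent (\<lambda>k. \<Sum>i<n. (norm (decentlam_x n W f \<gamma> \<beta> x0 k i - xstar))\<^sup>2) \<and>
        lim (\<lambda>k. \<Sum>i<n. (norm (decentlam_x n W f \<gamma> \<beta> x0 k i - xstar))\<^sup>2)
          \<le> 4 * K\<^sup>2 * real n * (\<gamma>\<^sup>2 * data_inconsistency_sq n f xstar / (1 - \<rho>)\<^sup>2)"
      by blast
  qed
qed

end
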